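(* Let $S$ be a Boolean restriction semigroup with local units. Then $S$ admits a structure of a range semigroup (that is, there is a unary operation ${}^+$ on $S$ such that $(S;\cdot,{}^*,{}^+)$ is a range semigroup) if and only if its category of germs is strongly ample.
   Context: A restriction semigroup is an algebra $(S;\cdot,{}^* )$ where $(S;\cdot)$ is a semigroup and ${}^*$ is unary with $xx^*=x$, $x^*y^*=y^*x^*=(x^*y^* )^*$, $(xy)^*=(x^*y)^*$, $x^*y=y(xy)^*$. Projections: $P(S)=\{s^*:s\in S\}$. Natural partial order: $s\le t$ iff $s=ts^*$; $s\vee t$ is the least upper bound with respect to $\le$, if it exists. A generalized Boolean algebra is a relatively complemented distributive lattice with bottom $0$. A restriction semigroup with a left zero $0$ that is a projection is Boolean if: $s\vee t$ exists whenever $st^*=ts^*$; $(P(S),\le)$ is a generalized Boolean algebra; $(s\vee t)u=su\vee tu$ whenever $s\vee t$ exists. $S$ has local units if for every $s\in S$ there is $e\in P(S)$ with $es=s$. A range semigroup is an algebra $(S;\cdot,{}^*,{}^+)$ with $(S;\cdot,{}^* )$ a restriction semigroup and $x^+x=x$, $x^+y^+=y^+x^+=(x^+y^+)^+$, $(xy)^+=(xy^+)^+$, $(x^+)^*=x^+$, $(x^* )^+=x^*$. Category of germs: a prime character of $P(S)$ is a non-zero morphism of generalized Boolean algebras $P(S)\to\{0,1\}$; $\widehat{P(S)}$ is the set of prime characters with basis of topology $D_e=\{\varphi:\varphi(e)=1\}$, $e\in P(S)$. If $\varphi(s^* )=1$, $(s\circ\varphi)(e)=\varphi((es)^* )$ defines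 a prime character. On $\Omega=\{(s,\varphi)\in S\times\widehat{P(S)}:\varphi(s^* )=1\}$ put $(s,\varphi)\sim(t,\psi)$ iff $\varphi=\psi$ and there is $u\le s,t$ with $\varphi(u^* )=1$; the class of $(s,\varphi)$ is the germ $[s,\varphi]$. The category of germs has space of arrows $C_1=\Omega/{\sim}$, space of objects $C_0=\widehat{P(S)}$, domain $d([s,\varphi])=\varphi$, range $r([s,\varphi])=s\circ\varphi$, unit $u(\varphi)=[e,\varphi]$ for any $e\in P(S)$ with $\varphi(e)=1$, multiplication $[s,t\circ\psi][t,\psi]=[st,\psi]$; $C_1$ has as basis the sets $\Theta(s)=\{[s,\varphi]:\varphi(s^* )=1\}$, $s\in S$. A topological category (small category internal to topological spaces, with domain map $d$ and range map $r$) is étale if its object space is locally compact Hausdorff and $d$ is a local homeomorphism; ample if étale and the compact slices (compact open sets of arrows on which $d$ is injective) form a basis of the space of arrows; strongly ample if ample and $r$ is an open map. *)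

theory Defs
  imports "HOL-Analysis.Analysis" "HOL-Algebra.Lattice"
begin

section \<open>Generalized Boolean algebras\<close>

locale generalized_boolean_algebra =
  Lattice.lattice L + weak_partial_order_bottom L for L (structure) +
  assumes distrib:
    "\<lbrakk>x \<in> carrier L; y \<in> carrier L; z \<in> carrier L\<rbrakk>
      \<Longrightarrow> x \<sqinter> (y \<squnion> z) = (x \<sqinter> y) \<squnion> (x \<sqinter> z)"
    and relatively_complemented:
    "\<lbrakk>a \<in> carrier L; b \<in> carrier L; x \<in> \<lbrace>a..b\<rbrace>\<rbrakk>
      \<Longrightarrow> \<exists>y\<in>\<lbrace>a..b\<rbrace>. x \<squnion> y = b \<and> x \<sqinter> y = a"

text \<open>Relative complements are unique in a distributive lattice, so they are preserved by any map
  that preserves binary joins, binary meets and the bottom element.\<close>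

definition gba_hom :: "('a, 'c) gorder_scheme \<Rightarrow> ('b, 'd) gorder_scheme \<Rightarrow> ('a \<Rightarrow> 'b) \<Rightarrow> bool" where
  "gba_hom X Y f \<longleftrightarrow>
     f \<in> carrier X \<rightarrow> carrier Y \<and> join_pres X Y f \<and> meet_pres X Y f \<and> f \<bottom>\<^bsub>X\<^esub> = \<bottom>\<^bsub>Y\<^esub>"

text \<open>The two-element algebra \<open>{0,1}\<close>, with \<open>False\<close> for 0 and \<open>True\<close> for 1.\<close>

definition two_gba :: "bool gorder" where
  "two_gba = \<lparr>carrier = UNIV, eq = (=), le = (\<le>)\<rparr>"

section \<open>Restriction semigroups and range semigroups\<close>

locale restriction_semigroup = semigroup mul
  for mul :: "'a \<Rightarrow> 'a \<Rightarrow> 'a" (infixl \<open>\<cdot>\<close> 70) +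
  fixes star :: "'a \<Rightarrow> 'a" (\<open>_\<^sup>\<star>\<close> [1000] 1000)
  assumes mul_star: "x \<cdot> x\<^sup>\<star> = x"
    and star_commute: "x\<^sup>\<star> \<cdot> y\<^sup>\<star> = y\<^sup>\<star> \<cdot> x\<^sup>\<star>"
    and star_mul_stars: "(x\<^sup>\<star> \<cdot> y\<^sup>\<star>)\<^sup>\<star> = x\<^sup>\<star> \<cdot> y\<^sup>\<star>"
    and star_mul: "(x \<cdot> y)\<^sup>\<star> = (x\<^sup>\<star> \<cdot> y)\<^sup>\<star>"
    and ample: "x\<^sup>\<star> \<cdot> y = y \<cdot> (x \<cdot> y)\<^sup>\<star>"
begin

definition projections :: "'a set" where
  "projections = range star"

definition natural_order :: "'a gorder" where
  "natural_order = \<lparr>carrier = UNIV, eq = (=), le = (\<lambda>s t. s = t \<cdot> s\<^sup>\<star>)\<rparr>"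

definition projection_order :: "'a gorder" where
  "projection_order = natural_order\<lparr>carrier := projections\<rparr>"

text \<open>Joins in \<open>S\<close> are partial: \<open>is_join s t j\<close> says that the join of \<open>s\<close> and \<open>t\<close> exists
  and equals \<open>j\<close>.\<close>

definition is_join :: "'a \<Rightarrow> 'a \<Rightarrow> 'a \<Rightarrow> bool" where
  "is_join s t j \<longleftrightarrow> least natural_order j (Upper natural_order {s, t})"

definition has_local_units :: bool where
  "has_local_units \<longleftrightarrow> (\<forall>s. \<exists>e\<in>projections. e \<cdot> s = s)"

end

locale range_semigroup = restriction_semigroup mul star
  for mul :: "'a \<Rightarrow> 'a \<Rightarrow> 'a" (infixl \<open>\<cdot>\<close> 70)
    and star :: "'a \<Rightarrow> 'a" (\<open>_\<^sup>\<star>\<close> [1000] 1000) +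
  fixes plus :: "'a \<Rightarrow> 'a" (\<open>_\<^sup>\<oplus>\<close> [1000] 1000)
  assumes plus_mul: "x\<^sup>\<oplus> \<cdot> x = x"
    and plus_commute: "x\<^sup>\<oplus> \<cdot> y\<^sup>\<oplus> = y\<^sup>\<oplus> \<cdot> x\<^sup>\<oplus>"
    and plus_mul_pluses: "(x\<^sup>\<oplus> \<cdot> y\<^sup>\<oplus>)\<^sup>\<oplus> = x\<^sup>\<oplus> \<cdot> y\<^sup>\<oplus>"
    and plus_of_mul: "(x \<cdot> y)\<^sup>\<oplus> = (x \<cdot> y\<^sup>\<oplus>)\<^sup>\<oplus>"
    and star_plus: "(x\<^sup>\<oplus>)\<^sup>\<star> = x\<^sup>\<oplus>"
    and plus_star: "(x\<^sup>\<star>)\<^sup>\<oplus> = x\<^sup>\<star>"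

locale boolean_restriction_semigroup = restriction_semigroup mul star
  for mul :: "'a \<Rightarrow> 'a \<Rightarrow> 'a" (infixl \<open>\<cdot>\<close> 70)
    and star :: "'a \<Rightarrow> 'a" (\<open>_\<^sup>\<star>\<close> [1000] 1000) +
  fixes zero :: 'a
  assumes left_zero: "zero \<cdot> s = zero"
    and zero_projection: "zero \<in> projections"
    and join_exists: "s \<cdot> t\<^sup>\<star> = t \<cdot> s\<^sup>\<star> \<Longrightarrow> \<exists>j. is_join s t j"
    and projections_gba: "generalized_boolean_algebra projection_order"
    and join_mul: "is_join s t j \<Longrightarrow> is_join (s \<cdot> u) (t \<cdot> u) (j \<cdot> u)"

section \<open>Topological categories\<close>

text \<open>\<open>cat_mult C x y\<close> is the composite of \<open>y\<close> followed by \<open>x\<close>; it is meaningful only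
  if \<open>cat_dom C x = cat_ran C y\<close>.\<close>

record ('o, 'm) top_cat =
  cat_obj :: "'o topology"
  cat_arr :: "'m topology"
  cat_dom :: "'m \<Rightarrow> 'o"
  cat_ran :: "'m \<Rightarrow> 'o"
  cat_unit :: "'o \<Rightarrow> 'm"
  cat_mult :: "'m \<Rightarrow> 'm \<Rightarrow> 'm"

definition composable_space :: "('o, 'm) top_cat \<Rightarrow> ('m \<times> 'm) topology" where
  "composable_space C =
     subtopology (prod_topology (cat_arr C) (cat_arr C)) {(x, y). cat_dom C x = cat_ran C y}"

locale topological_category =
  fixes C :: "('o, 'm) top_cat"
  assumes continuous_dom: "continuous_map (cat_arr C) (cat_obj C) (cat_dom C)"
    and continuous_ran: "continuous_map (cat_arr C) (cat_obj C) (cat_ran C)"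
    and continuous_unit: "continuous_map (cat_obj C) (cat_arr C) (cat_unit C)"
    and continuous_mult:
      "continuous_map (composable_space C) (cat_arr C) (\<lambda>(x, y). cat_mult C x y)"
    and dom_unit: "a \<in> topspace (cat_obj C) \<Longrightarrow> cat_dom C (cat_unit C a) = a"
    and ran_unit: "a \<in> topspace (cat_obj C) \<Longrightarrow> cat_ran C (cat_unit C a) = a"
    and dom_mult: "(x, y) \<in> topspace (composable_space C)
      \<Longrightarrow> cat_dom C (cat_mult C x y) = cat_dom C y"
    and ran_mult: "(x, y) \<in> topspace (composable_space C)
      \<Longrightarrow> cat_ran C (cat_mult C x y) = cat_ran C x"
    and mult_unit: "x \<in> topspace (cat_arr C) \<Longrightarrow> cat_mult C x (cat_unit C (cat_dom C x)) = x"
    and unit_mult: "x \<in> topspace (cat_arr C) \<Longrightarrow> cat_mult C (cat_unit C (cat_ran C x)) x = x"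
    and mult_assoc:
      "\<lbrakk>(x, y) \<in> topspace (composable_space C); (y, z) \<in> topspace (composable_space C)\<rbrakk>
        \<Longrightarrow> cat_mult C (cat_mult C x y) z = cat_mult C x (cat_mult C y z)"

definition local_homeomorphism :: "'a topology \<Rightarrow> 'b topology \<Rightarrow> ('a \<Rightarrow> 'b) \<Rightarrow> bool" where
  "local_homeomorphism X Y f \<longleftrightarrow>
     (\<forall>x\<in>topspace X. \<exists>U. openin X U \<and> x \<in> U \<and> openin Y (f ` U) \<and>
        homeomorphic_map (subtopology X U) (subtopology Y (f ` U)) f)"

locale etale_category = topological_category C for C :: "('o, 'm) top_cat" +
  assumes locally_compact_obj: "locally_compact_space (cat_obj C)"
    and Hausdorff_obj: "Hausdorff_space (cat_obj C)"
    and local_homeomorphism_dom: "local_homeomorphism (cat_arr C) (cat_obj C) (cat_dom C)"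

definition compact_slice :: "('o, 'm) top_cat \<Rightarrow> 'm set \<Rightarrow> bool" where
  "compact_slice C U \<longleftrightarrow>
     compactin (cat_arr C) U \<and> openin (cat_arr C) U \<and> inj_on (cat_dom C) U"

locale ample_category = etale_category C for C :: "('o, 'm) top_cat" +
  assumes compact_slices_basis: "openin (cat_arr C) = arbitrary union_of compact_slice C"

locale strongly_ample_category = ample_category C for C :: "('o, 'm) top_cat" +
  assumes open_ran: "open_map (cat_arr C) (cat_obj C) (cat_ran C)"

section \<open>The category of germs\<close>

context restriction_semigroup
begin

text \<open>A character is a function on the set of projections only; as an element of
  \<^typ>\<open>'a \<Rightarrow> bool\<close> it is fixed to be \<^const>\<open>undefined\<close> elsewhere.\<close>

definition prime_characters :: "('a \<Rightarrow> bool) set" where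
  "prime_characters =
     {\<phi> \<in> extensional projections. gba_hom projection_order two_gba \<phi> \<and> (\<exists>e\<in>projections. \<phi> e)}"

text \<open>The sets \<open>D\<^sub>e\<close> are closed under binary intersections, and any intersection
  \<open>\<Theta>(s) \<inter> \<Theta>(t)\<close> is a union of sets \<open>\<Theta>(u)\<close>; hence these families are bases, and
  not merely subbases, of the topologies they generate below.\<close>

definition character_space :: "('a \<Rightarrow> bool) topology" where
  "character_space =
     topology_generated_by ((\<lambda>e. {\<phi> \<in> prime_characters. \<phi> e}) ` projections)"

definition act :: "'a \<Rightarrow> ('a \<Rightarrow> bool) \<Rightarrow> ('a \<Rightarrow> bool)" where
  "act s \<phi> = (\<lambda>e\<in>projections. \<phi> ((e \<cdot> s)\<^sup>\<star>))"

definition germ_pairs :: "('a \<times> ('a \<Rightarrow> bool)) set" where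
  "germ_pairs = {(s, \<phi>). \<phi> \<in> prime_characters \<and> \<phi> (s\<^sup>\<star>)}"

definition germ_rel :: "(('a \<times> ('a \<Rightarrow> bool)) \<times> ('a \<times> ('a \<Rightarrow> bool))) set" where
  "germ_rel = {((s, \<phi>), (t, \<psi>)). (s, \<phi>) \<in> germ_pairs \<and> (t, \<psi>) \<in> germ_pairs \<and> \<phi> = \<psi> \<and>
     (\<exists>u. u \<sqsubseteq>\<^bsub>natural_order\<^esub> s \<and> u \<sqsubseteq>\<^bsub>natural_order\<^esub> t \<and> \<phi> (u\<^sup>\<star>))}"

definition germ :: "'a \<Rightarrow> ('a \<Rightarrow> bool) \<Rightarrow> ('a \<times> ('a \<Rightarrow> bool)) set" where
  "germ s \<phi> = germ_rel `` {(s, \<phi>)}"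

definition germ_slice :: "'a \<Rightarrow> ('a \<times> ('a \<Rightarrow> bool)) set set" where
  "germ_slice s = {germ s \<phi> |\<phi>. (s, \<phi>) \<in> germ_pairs}"

text \<open>The union of all \<open>\<Theta>(s)\<close> is the quotient \<^term>\<open>germ_pairs // germ_rel\<close>, which is
  therefore the underlying set of the space of arrows.\<close>

definition germ_space :: "('a \<times> ('a \<Rightarrow> bool)) set topology" where
  "germ_space = topology_generated_by (range germ_slice)"

definition germ_dom :: "('a \<times> ('a \<Rightarrow> bool)) set \<Rightarrow> ('a \<Rightarrow> bool)" where
  "germ_dom x = (THE \<eta>. \<exists>s \<phi>. (s, \<phi>) \<in> germ_pairs \<and> x = germ s \<phi> \<and> \<eta> = \<phi>)"

definition germ_ran :: "('a \<times> ('a \<Rightarrow> bool)) set \<Rightarrow> ('a \<Rightarrow> bool)" where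
  "germ_ran x = (THE \<eta>. \<exists>s \<phi>. (s, \<phi>) \<in> germ_pairs \<and> x = germ s \<phi> \<and> \<eta> = act s \<phi>)"

definition germ_unit :: "('a \<Rightarrow> bool) \<Rightarrow> ('a \<times> ('a \<Rightarrow> bool)) set" where
  "germ_unit \<phi> = (THE x. \<exists>e\<in>projections. \<phi> e \<and> x = germ e \<phi>)"

definition germ_mult ::
  "('a \<times> ('a \<Rightarrow> bool)) set \<Rightarrow> ('a \<times> ('a \<Rightarrow> bool)) set \<Rightarrow> ('a \<times> ('a \<Rightarrow> bool)) set" where
  "germ_mult x y = (THE z. \<exists>s t \<psi>. (t, \<psi>) \<in> germ_pairs \<and> (s, act t \<psi>) \<in> germ_pairs \<and>
     x = germ s (act t \<psi>) \<and> y = germ t \<psi> \<and> z = germ (s \<cdot> t) \<psi>)"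

definition germ_category :: "('a \<Rightarrow> bool, ('a \<times> ('a \<Rightarrow> bool)) set) top_cat" where
  "germ_category = \<lparr>cat_obj = character_space, cat_arr = germ_space,
     cat_dom = germ_dom, cat_ran = germ_ran, cat_unit = germ_unit, cat_mult = germ_mult\<rparr>"

end

end

theory Submission
  imports Defs
begin

text \<open>By Stone duality, characters separate projections, the sets
  \<open>D\<^sub>e = {\<phi>. \<phi> e}\<close> are compact, the space of characters is Hausdorff, and its compact open subsets
  are exactly the sets \<open>D\<^sub>e\<close>. The slice \<open>\<Theta>(s)\<close> is a homeomorphic copy of \<open>D\<^sub>e\<close> for \<open>e = s\<^sup>\<star>\<close> along
  the domain map, and these slices form a basis of the space of germs. Hence the category of germs
  is ample for every Boolean restriction semigroup with local units
  (\<open>ample_category_germs\<close>), and the theorem becomes the statement that a range operation exists if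
  and only if every set \<open>r(\<Theta>(s)) = {s \<circ> \<phi> | \<phi>. \<phi> (s\<^sup>\<star>)}\<close> is open.

  These sets are always compact, being continuous images of compact slices. If a range operation
  \<open>s \<mapsto> s\<^sup>+\<close> is given, then \<open>r(\<Theta>(s))\<close> is the open set \<open>D\<^sub>e\<close> for \<open>e = s\<^sup>+\<close>
  (\<open>act_image_eq_stone_set_plus\<close>). One inclusion is \<open>s\<^sup>+ \<cdot> s = s\<close>; for the other, \<open>r(\<Theta>(s))\<close> is
  closed, and a nonzero \<open>g \<le> s\<^sup>+\<close> whose \<open>D\<^sub>g\<close> avoids it would satisfy \<open>g \<cdot> s = 0\<close>, hence
  \<open>g = (g \<cdot> s)\<^sup>+ = 0\<close>. Conversely, if \<open>r(\<Theta>(s))\<close> is open, then it is compact open, so it equals \<open>D\<^sub>e\<close>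
  for a unique projection \<open>e\<close>; setting \<open>s\<^sup>+ = e\<close> gives a range operation, because each of its axioms
  can be checked by comparing sets of characters (\<open>range_semigroup_if_act_images_open\<close>).\<close>

section \<open>Restriction semigroups and their natural order\<close>

context restriction_semigroup
begin

definition natural_le :: "'a \<Rightarrow> 'a \<Rightarrow> bool" (infix \<open>\<preceq>\<close> 50) where
  "s \<preceq> t \<longleftrightarrow> s = t \<cdot> s\<^sup>\<star>"

lemma natural_order_simps [simp]:
  "carrier natural_order = UNIV" "eq natural_order = (=)" "s \<sqsubseteq>\<^bsub>natural_order\<^esub> t \<longleftrightarrow> s \<preceq> t"
  by (simp_all add: natural_order_def natural_le_def)

lemma projection_order_simps [simp]:
  "carrier projection_order = projections" "eq projection_order = (=)"
  "s \<sqsubseteq>\<^bsub>projection_order\<^esub> t \<longleftrightarrow> s \<preceq> t"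
  by (simp_all add: projection_order_def natural_order_def natural_le_def)

lemma star_projection [simp]: "s\<^sup>\<star> \<in> projections"
  by (simp add: projections_def)

lemma star_idem: "s\<^sup>\<star> \<cdot> s\<^sup>\<star> = s\<^sup>\<star>"
  by (metis mul_star star_mul star_mul_stars)

lemma projection_star [simp]: "e \<in> projections \<Longrightarrow> e\<^sup>\<star> = e"
  unfolding projections_def by (metis imageE star_idem star_mul_stars)

lemma projection_idem [simp]: "e \<in> projections \<Longrightarrow> e \<cdot> e = e"
  by (metis projection_star star_idem)

lemma projection_mul [simp]:
  assumes "e \<in> projections" "f \<in> projections" shows "e \<cdot> f \<in> projections"
  by (metis assms projection_star star_mul_stars star_projection)

lemma projection_commute: "\<lbrakk>e \<in> projections; f \<in> projections\<rbrakk> \<Longrightarrow> e \<cdot> f = f \<cdot> e"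
  by (metis projection_star star_commute)

lemma projection_left_idem [simp]: "e \<in> projections \<Longrightarrow> e \<cdot> (e \<cdot> s) = e \<cdot> s"
  by (metis assoc projection_idem)

lemma projection_left_commute:
  "\<lbrakk>e \<in> projections; f \<in> projections\<rbrakk> \<Longrightarrow> e \<cdot> (f \<cdot> s) = f \<cdot> (e \<cdot> s)"
  by (metis assoc projection_commute)

lemma projection_mul_eq: "e \<in> projections \<Longrightarrow> e \<cdot> s = s \<cdot> (e \<cdot> s)\<^sup>\<star>"
  by (metis ample projection_star)

lemma star_mul_projection:
  assumes "e \<in> projections" shows "(s \<cdot> e)\<^sup>\<star> = s\<^sup>\<star> \<cdot> e"
  by (metis assms projection_mul projection_star star_mul star_projection)

lemma natural_le_refl: "s \<preceq> s"
  by (simp add: natural_le_def mul_star)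

lemma star_mono: "s \<preceq> t \<Longrightarrow> t\<^sup>\<star> \<cdot> s\<^sup>\<star> = s\<^sup>\<star>"
  by (metis natural_le_def star_mul_projection star_projection)

lemma natural_le_trans:
  assumes "s \<preceq> t" "t \<preceq> u" shows "s \<preceq> u"
  by (metis assms assoc natural_le_def star_mono)

lemma natural_le_antisym:
  assumes "s \<preceq> t" "t \<preceq> s" shows "s = t"
proof -
  have "s\<^sup>\<star> = t\<^sup>\<star>"
    using star_mono[OF assms(1)] star_mono[OF assms(2)] star_commute by metis
  then show ?thesis
    using assms(1) mul_star unfolding natural_le_def by metis
qed

lemma mul_projection_le:
  assumes "e \<in> projections" shows "s \<cdot> e \<preceq> s"
  by (metis assms assoc mul_star natural_le_def star_mul_projection)

lemma projection_mul_le: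
  assumes "e \<in> projections" shows "e \<cdot> s \<preceq> s"
  using projection_mul_eq[OF assms] unfolding natural_le_def .

lemma projection_le_iff: "e \<in> projections \<Longrightarrow> e \<preceq> f \<longleftrightarrow> f \<cdot> e = e"
  by (auto simp: natural_le_def)

lemma le_projection: "\<lbrakk>s \<preceq> e; e \<in> projections\<rbrakk> \<Longrightarrow> s \<in> projections"
  by (metis natural_le_def projection_mul star_projection)

text \<open>A projection such as \<open>a\<^sup>\<star>\<close> standing inside the product \<open>s \<cdot> a\<^sup>\<star> \<cdot> b\<close> can be moved to the
  right end by the ample identity, where multiplying by projections only makes elements smaller.\<close>

lemma mul_mono:
  assumes "a \<preceq> s" "b \<preceq> t" shows "a \<cdot> b \<preceq> s \<cdot> t"
proof -
  have "a \<cdot> b = s \<cdot> (a\<^sup>\<star> \<cdot> b)"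
    by (metis assms(1) assoc natural_le_def)
  also have "\<dots> = s \<cdot> (b \<cdot> (a \<cdot> b)\<^sup>\<star>)"
    by (simp only: ample)
  also have "\<dots> = s \<cdot> t \<cdot> (b\<^sup>\<star> \<cdot> (a \<cdot> b)\<^sup>\<star>)"
    by (metis assms(2) assoc natural_le_def)
  finally show ?thesis
    by (metis mul_projection_le projection_mul star_projection)
qed

text \<open>The map \<open>e \<mapsto> (e \<cdot> s)\<^sup>\<star>\<close>, through which \<open>s\<close> acts on characters, preserves meets: the ample
  identity turns \<open>e \<cdot> f \<cdot> s\<close> into \<open>e \<cdot> s \<cdot> (f \<cdot> s)\<^sup>\<star>\<close>.\<close>

lemma star_projection_mul_mul:
  assumes "e \<in> projections" "f \<in> projections"
  shows "((e \<cdot> f) \<cdot> s)\<^sup>\<star> = (e \<cdot> s)\<^sup>\<star> \<cdot> (f \<cdot> s)\<^sup>\<star>"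
proof -
  have "(e \<cdot> f) \<cdot> s = (e \<cdot> s) \<cdot> (f \<cdot> s)\<^sup>\<star>"
    by (metis assms(2) assoc projection_mul_eq)
  then show ?thesis
    by (simp add: star_mul_projection)
qed

end

section \<open>The generalized Boolean algebra of projections\<close>

sublocale boolean_restriction_semigroup \<subseteq> projection_lattice: generalized_boolean_algebra projection_order
  by (rule projections_gba)

context boolean_restriction_semigroup
begin

abbreviation proj_join :: "'a \<Rightarrow> 'a \<Rightarrow> 'a" (infixl \<open>\<squnion>\<close> 65) where
  "e \<squnion> f \<equiv> e \<squnion>\<^bsub>projection_order\<^esub> f"

declare left_zero [simp] zero_projection [simp]

text \<open>Since the left zero is a projection, the ample identity turns \<open>s \<cdot> zero\<close> into \<open>zero \<cdot> s\<close>.\<close>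

lemma mul_zero [simp]: "s \<cdot> zero = zero"
  by (metis ample left_zero projection_star zero_projection)

lemma eq_zero_iff_star: "s\<^sup>\<star> = zero \<longleftrightarrow> s = zero"
  by (metis mul_star mul_zero projection_star zero_projection)

lemma proj_join_closed [simp]: "\<lbrakk>e \<in> projections; f \<in> projections\<rbrakk> \<Longrightarrow> e \<squnion> f \<in> projections"
  using projection_lattice.join_closed by simp

lemma proj_join_absorb:
  assumes "e \<in> projections" "f \<in> projections"
  shows "(e \<squnion> f) \<cdot> e = e" "(e \<squnion> f) \<cdot> f = f"
  using projection_lattice.join_left[of e f] projection_lattice.join_right[of e f] assms
  by (simp_all add: projection_le_iff)

lemma proj_join_least:
  assumes "e \<in> projections" "f \<in> projections" "g \<in> projections" "g \<cdot> e = e" "g \<cdot> f = f"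
  shows "g \<cdot> (e \<squnion> f) = e \<squnion> f"
  using projection_lattice.join_le[of e g f] assms by (simp add: projection_le_iff)

lemma proj_meet_eq_mul:
  assumes "e \<in> projections" "f \<in> projections"
  shows "e \<sqinter>\<^bsub>projection_order\<^esub> f = e \<cdot> f"
proof (rule projection_lattice.meetI)
  fix i assume i: "is_glb projection_order i {e, f}"
  have "e \<cdot> f \<preceq> e" "e \<cdot> f \<preceq> f"
    using assms by (simp_all add: mul_projection_le projection_mul_le)
  then have "e \<cdot> f \<preceq> i"
    using i assms by (auto simp: greatest_def Lower_def)
  moreover have "i \<in> projections" "e \<cdot> i = i" "f \<cdot> i = i"
    using i assms by (auto simp: greatest_def Lower_def projection_le_iff)
  ultimately show "i = e \<cdot> f"
    using assms by (metis assoc projection_commute projection_mul projection_le_iff)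
qed (use assms in simp_all)

lemma bottom_eq_zero: "\<bottom>\<^bsub>projection_order\<^esub> = zero"
proof -
  have "\<bottom>\<^bsub>projection_order\<^esub> \<in> projections" "\<bottom>\<^bsub>projection_order\<^esub> \<preceq> zero"
    using projection_lattice.bottom_closed projection_lattice.bottom_lower[of zero] by simp_all
  then show ?thesis
    by (simp add: projection_le_iff)
qed

lemma proj_distrib:
  assumes "e \<in> projections" "f \<in> projections" "g \<in> projections"
  shows "e \<cdot> (f \<squnion> g) = e \<cdot> f \<squnion> e \<cdot> g"
  using projection_lattice.distrib[of e f g] assms by (simp add: proj_meet_eq_mul)

lemma zero_proj_join [simp]:
  assumes "e \<in> projections" shows "zero \<squnion> e = e"
proof -
  have "e \<cdot> (zero \<squnion> e) = zero \<squnion> e"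
    using assms by (intro proj_join_least) simp_all
  moreover have "(zero \<squnion> e) \<cdot> e = e"
    using assms by (intro proj_join_absorb) simp_all
  moreover have "e \<cdot> (zero \<squnion> e) = (zero \<squnion> e) \<cdot> e"
    using assms by (intro projection_commute) simp_all
  ultimately show ?thesis
    by metis
qed

lemma ex_difference:
  assumes "e \<in> projections" "f \<in> projections"
  obtains d where "d \<in> projections" "d \<cdot> f = zero" "d \<squnion> e \<cdot> f = e" "e \<cdot> d = d"
proof -
  have "e \<cdot> f \<in> \<lbrace>zero..e\<rbrace>\<^bsub>projection_order\<^esub>"
    using assms mul_projection_le[of f e] by (simp add: at_least_at_most_def projection_le_iff)
  then obtain d where d: "d \<in> \<lbrace>zero..e\<rbrace>\<^bsub>projection_order\<^esub>"
      and "e \<cdot> f \<squnion> d = e" "e \<cdot> f \<sqinter>\<^bsub>projection_order\<^esub> d = zero"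
    using projection_lattice.relatively_complemented[of zero e "e \<cdot> f"] assms by auto
  moreover from d have "d \<in> projections" "e \<cdot> d = d"
    by (auto simp: at_least_at_most_def projection_le_iff)
  ultimately have "d \<squnion> e \<cdot> f = e" "d \<cdot> f = zero" 
    using assms
    by (auto simp: proj_meet_eq_mul join_def insert_commute) (metis assoc projection_commute)
  with \<open>d \<in> projections\<close> \<open>e \<cdot> d = d\<close> show thesis
    using that by blast
qed

lemma is_join_iff:
  "is_join s t j \<longleftrightarrow> s \<preceq> j \<and> t \<preceq> j \<and> (\<forall>k. s \<preceq> k \<longrightarrow> t \<preceq> k \<longrightarrow> j \<preceq> k)"
  by (auto simp: is_join_def least_def Upper_def)

text \<open>The join of two projections among all elements is below any projection above both, hence
  is itself a projection: joins of projections in \<open>S\<close> and in \<open>P(S)\<close> agree.\<close>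

lemma is_join_proj_join:
  assumes "e \<in> projections" "f \<in> projections"
  shows "is_join e f (e \<squnion> f)"
proof -
  have "e \<cdot> f\<^sup>\<star> = f \<cdot> e\<^sup>\<star>"
    using assms by (simp add: projection_commute)
  then obtain j where j: "is_join e f j"
    using join_exists by blast
  have "j \<preceq> e \<squnion> f"
    using j assms by (simp add: is_join_iff projection_le_iff proj_join_absorb)
  then have "j \<in> projections"
    using assms by (meson le_projection proj_join_closed)
  moreover have "j \<cdot> e = e" "j \<cdot> f = f"
    using j assms by (auto simp: is_join_iff projection_le_iff)
  ultimately have "e \<squnion> f \<preceq> j"
    using assms by (simp add: projection_le_iff proj_join_least)
  with \<open>j \<preceq> e \<squnion> f\<close> have "j = e \<squnion> f"
    by (rule natural_le_antisym)
  with j show ?thesis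
    by simp
qed

text \<open>If \<open>g\<close> is the join of \<open>s\<^sup>\<star>\<close> and \<open>t\<^sup>\<star>\<close>, then \<open>j \<cdot> g\<close> is still above \<open>s\<close> and \<open>t\<close>, so that the least
  upper bound \<open>j\<close> cannot have a domain larger than \<open>g\<close>.\<close>

lemma star_is_join:
  assumes "is_join s t j" shows "j\<^sup>\<star> = s\<^sup>\<star> \<squnion> t\<^sup>\<star>"
proof -
  let ?g = "s\<^sup>\<star> \<squnion> t\<^sup>\<star>"
  have "s \<preceq> j" "t \<preceq> j"
    using assms by (auto simp: is_join_iff)
  have "j\<^sup>\<star> \<cdot> ?g = ?g"
    using star_mono[OF \<open>s \<preceq> j\<close>] star_mono[OF \<open>t \<preceq> j\<close>] by (simp add: proj_join_least)
  have "s \<preceq> j \<cdot> ?g" "t \<preceq> j \<cdot> ?g"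
    using \<open>s \<preceq> j\<close> \<open>t \<preceq> j\<close> unfolding natural_le_def by (metis assoc proj_join_absorb star_projection)+
  then have "j \<preceq> j \<cdot> ?g"
    using assms by (auto simp: is_join_iff)
  then have "(j \<cdot> ?g)\<^sup>\<star> \<cdot> j\<^sup>\<star> = j\<^sup>\<star>"
    by (rule star_mono)
  then show ?thesis
    by (metis \<open>j\<^sup>\<star> \<cdot> ?g = ?g\<close> projection_commute proj_join_closed star_mul_projection star_projection
        projection_left_idem)
qed

text \<open>The map \<open>e \<mapsto> (e \<cdot> s)\<^sup>\<star>\<close> preserves joins; this is where right distributivity of multiplication over
  joins enters.\<close>

lemma star_proj_join_mul:
  assumes "e \<in> projections" "f \<in> projections"
  shows "((e \<squnion> f) \<cdot> s)\<^sup>\<star> = (e \<cdot> s)\<^sup>\<star> \<squnion> (f \<cdot> s)\<^sup>\<star>"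
  using assms is_join_proj_join join_mul star_is_join by blast

end

section \<open>Prime characters\<close>

lemma lattice_two_gba: "Lattice.lattice two_gba"
proof -
  have "is_lub two_gba (x \<or> y) {x, y}" "is_glb two_gba (x \<and> y) {x, y}" for x y
    by (auto simp: two_gba_def least_def Upper_def greatest_def Lower_def)
  then show ?thesis
    by unfold_locales (fastforce simp: two_gba_def)+
qed

lemma two_gba_simps:
  "x \<squnion>\<^bsub>two_gba\<^esub> y \<longleftrightarrow> x \<or> y" "x \<sqinter>\<^bsub>two_gba\<^esub> y \<longleftrightarrow> x \<and> y" "\<bottom>\<^bsub>two_gba\<^esub> = False"
proof -
  interpret two_gba: Lattice.lattice two_gba
    by (rule lattice_two_gba)
  show "x \<squnion>\<^bsub>two_gba\<^esub> y \<longleftrightarrow> x \<or> y"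
    by (rule two_gba.joinI) (auto simp: two_gba_def least_def Upper_def)
  show "x \<sqinter>\<^bsub>two_gba\<^esub> y \<longleftrightarrow> x \<and> y"
    by (rule two_gba.meetI) (auto simp: two_gba_def greatest_def Lower_def)
  show "\<bottom>\<^bsub>two_gba\<^esub> = False"
    unfolding bottom_def by (rule some_equality) (auto simp: two_gba_def least_def)
qed

context boolean_restriction_semigroup
begin

lemma prime_characters_iff:
  "\<phi> \<in> prime_characters \<longleftrightarrow> \<phi> \<in> extensional projections \<and> \<not> \<phi> zero \<and> (\<exists>e\<in>projections. \<phi> e) \<and>
    (\<forall>e\<in>projections. \<forall>f\<in>projections. (\<phi> (e \<cdot> f) \<longleftrightarrow> \<phi> e \<and> \<phi> f) \<and> (\<phi> (e \<squnion> f) \<longleftrightarrow> \<phi> e \<or> \<phi> f))"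
  using lattice_two_gba projection_lattice.lattice_axioms
  by (auto simp: prime_characters_def gba_hom_def join_pres_def meet_pres_def proj_meet_eq_mul
      two_gba_simps bottom_eq_zero) (auto simp: two_gba_def)

lemma
  assumes "\<phi> \<in> prime_characters"
  shows character_extensional: "\<phi> \<in> extensional projections"
    and character_zero: "\<not> \<phi> zero"
    and character_nonzero: "\<exists>e\<in>projections. \<phi> e"
    and character_mul: "\<lbrakk>e \<in> projections; f \<in> projections\<rbrakk> \<Longrightarrow> \<phi> (e \<cdot> f) \<longleftrightarrow> \<phi> e \<and> \<phi> f"
    and character_join: "\<lbrakk>e \<in> projections; f \<in> projections\<rbrakk> \<Longrightarrow> \<phi> (e \<squnion> f) \<longleftrightarrow> \<phi> e \<or> \<phi> f"
  using assms unfolding prime_characters_iff by blast+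

lemma character_mono:
  assumes "\<phi> \<in> prime_characters" "\<phi> (s\<^sup>\<star>)" "s \<preceq> t" shows "\<phi> (t\<^sup>\<star>)"
  using assms by (metis character_mul star_mono star_projection)

lemma character_eqI:
  assumes "\<phi> \<in> prime_characters" "\<psi> \<in> prime_characters"
    and "\<And>e. e \<in> projections \<Longrightarrow> \<phi> e = \<psi> e"
  shows "\<phi> = \<psi>"
  by (rule extensionalityI[of _ projections]) (use assms character_extensional in auto)

text \<open>A maximal filter containing \<open>e\<close> and avoiding zero is prime: if it contains neither \<open>x\<close>
  nor \<open>y\<close>, then maximality provides members disjoint from \<open>x\<close> and from \<open>y\<close>, whose meet is
  disjoint from \<open>x \<squnion> y\<close> by distributivity.\<close>

lemma ex_character:
  assumes e: "e \<in> projections" "e \<noteq> zero"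
  obtains \<phi> where "\<phi> \<in> prime_characters" "\<phi> e"
proof -
  define filters where "filters = {F. F \<subseteq> projections \<and> e \<in> F \<and> zero \<notin> F \<and>
    (\<forall>a\<in>F. \<forall>b\<in>F. a \<cdot> b \<in> F) \<and> (\<forall>a\<in>F. \<forall>b\<in>projections. b \<cdot> a = a \<longrightarrow> b \<in> F)}"
  have "{f \<in> projections. f \<cdot> e = e} \<in> filters"
    using e by (auto simp: filters_def assoc) (metis assoc)
  moreover have "\<Union>\<C> \<in> filters" if "\<C> \<noteq> {}" "subset.chain filters \<C>" for \<C>
  proof -
    have "a \<cdot> b \<in> \<Union>\<C>" if ab: "a \<in> \<Union>\<C>" "b \<in> \<Union>\<C>" for a b
    proof -
      obtain F G where "F \<in> \<C>" "a \<in> F" "G \<in> \<C>" "b \<in> G"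
        using ab by blast
      moreover have "F \<subseteq> G \<or> G \<subseteq> F"
        using \<open>subset.chain filters \<C>\<close> calculation by (simp add: subset_chain_def)
      moreover have "\<C> \<subseteq> filters"
        using \<open>subset.chain filters \<C>\<close> by (simp add: subset_chain_def)
      ultimately show ?thesis
        unfolding filters_def by blast
    qed
    moreover have "\<C> \<subseteq> filters"
      using \<open>subset.chain filters \<C>\<close> by (simp add: subset_chain_def)
    ultimately show ?thesis
      using \<open>\<C> \<noteq> {}\<close> unfolding filters_def mem_Collect_eq by blast
  qed
  ultimately obtain F where "F \<in> filters" and max: "\<And>G. \<lbrakk>G \<in> filters; F \<subseteq> G\<rbrakk> \<Longrightarrow> G = F"
    using subset_Zorn_nonempty[of filters] by blast
  have F: "F \<subseteq> projections" "e \<in> F" "zero \<notin> F"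
      and F_mul: "\<And>a b. \<lbrakk>a \<in> F; b \<in> F\<rbrakk> \<Longrightarrow> a \<cdot> b \<in> F"
      and F_up: "\<And>a b. \<lbrakk>a \<in> F; b \<in> projections; b \<cdot> a = a\<rbrakk> \<Longrightarrow> b \<in> F"
    using \<open>F \<in> filters\<close> unfolding filters_def by blast+
  have disjoint: "\<exists>a\<in>F. a \<cdot> x = zero" if x: "x \<in> projections" "x \<notin> F" for x
  proof (rule ccontr)
    assume no: "\<not> (\<exists>a\<in>F. a \<cdot> x = zero)"
    \<comment> \<open>the filter generated by \<open>F\<close> and \<open>x\<close>\<close>
    define G where "G = {z \<in> projections. \<exists>a\<in>F. z \<cdot> (a \<cdot> x) = a \<cdot> x}"
    have "F \<subseteq> G"
      using F(1) by (auto simp: G_def) (metis projection_left_idem subset_eq)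
    moreover have "x \<in> G"
      using x F(1,2) unfolding G_def mem_Collect_eq
      by (metis assoc projection_commute projection_idem subset_eq)
    moreover have "zero \<notin> G"
      using no by (auto simp: G_def)
    moreover have "a \<cdot> b \<in> G" if ab: "a \<in> G" "b \<in> G" for a b
    proof -
      obtain c d where cd: "c \<in> F" "d \<in> F" "a \<cdot> (c \<cdot> x) = c \<cdot> x" "b \<cdot> (d \<cdot> x) = d \<cdot> x"
        using ab by (auto simp: G_def)
      have P: "a \<in> projections" "b \<in> projections" "c \<in> projections" "d \<in> projections"
        using ab cd F(1) by (auto simp: G_def)
      have "a \<cdot> b \<cdot> (c \<cdot> d \<cdot> x) = a \<cdot> (c \<cdot> (b \<cdot> (d \<cdot> x)))"
        using P by (simp add: assoc projection_left_commute[of b c])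
      also have "\<dots> = d \<cdot> (a \<cdot> (c \<cdot> x))"
        using P cd by (simp add: projection_left_commute[of c d] projection_left_commute[of a d])
      also have "\<dots> = c \<cdot> d \<cdot> x"
        using P cd by (simp add: assoc projection_left_commute[of d c])
      finally have "a \<cdot> b \<cdot> (c \<cdot> d \<cdot> x) = c \<cdot> d \<cdot> x" .
      then show ?thesis
        unfolding G_def
        by (intro CollectI conjI bexI[of _ "c \<cdot> d"]) (use P cd F_mul in simp_all)
    qed
    moreover have "b \<in> G" if "a \<in> G" "b \<in> projections" "b \<cdot> a = a" for a b
      using that unfolding G_def mem_Collect_eq by (metis assoc)
    moreover have "G \<subseteq> projections"
      by (auto simp: G_def)
    ultimately have "G \<in> filters"
      using F(2) unfolding filters_def by blast
    with max \<open>F \<subseteq> G\<close> \<open>x \<in> G\<close> x show False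
      by blast
  qed
  define \<phi> where "\<phi> = (\<lambda>f\<in>projections. f \<in> F)"
  have "x \<cdot> y \<in> F \<longleftrightarrow> x \<in> F \<and> y \<in> F" if "x \<in> projections" "y \<in> projections" for x y
    using that F_mul F_up[of "x \<cdot> y"] by (metis assoc projection_commute projection_idem)
  moreover have "x \<squnion> y \<in> F \<longleftrightarrow> x \<in> F \<or> y \<in> F" if P: "x \<in> projections" "y \<in> projections" for x y
  proof
    assume xy: "x \<squnion> y \<in> F"
    show "x \<in> F \<or> y \<in> F"
    proof (rule ccontr)
      assume "\<not> (x \<in> F \<or> y \<in> F)"
      then obtain a b where ab: "a \<in> F" "b \<in> F" "a \<cdot> x = zero" "b \<cdot> y = zero"
        using disjoint P by blast
      have "a \<in> projections" "b \<in> projections"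
        using ab F(1) by auto
      then have "a \<cdot> b \<cdot> x = zero" "a \<cdot> b \<cdot> y = zero"
        using ab P by (metis assoc mul_zero projection_commute)+
      then have "a \<cdot> b \<cdot> (x \<squnion> y) = zero"
        using P \<open>a \<in> projections\<close> \<open>b \<in> projections\<close> by (simp add: proj_distrib)
      with F(3) F_mul ab xy show False
        by metis
    qed
  next
    assume "x \<in> F \<or> y \<in> F"
    then show "x \<squnion> y \<in> F"
      using F_up P by (metis proj_join_absorb proj_join_closed)
  qed
  ultimately have "\<phi> \<in> prime_characters"
    using F e by (auto simp: prime_characters_iff \<phi>_def)
  moreover have "\<phi> e"
    using F e by (simp add: \<phi>_def)
  ultimately show thesis
    using that by blast
qed

text \<open>If \<open>e\<close> is not below \<open>f\<close>, some character is positive on the nonzero difference of \<open>e\<close> and \<open>f\<close>; such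
  a character separates \<open>e\<close> from \<open>f\<close>.\<close>

lemma projection_le_if_characters_le:
  assumes P: "e \<in> projections" "f \<in> projections"
    and le: "\<And>\<phi>. \<lbrakk>\<phi> \<in> prime_characters; \<phi> e\<rbrakk> \<Longrightarrow> \<phi> f"
  shows "e \<cdot> f = e"
proof -
  obtain d where d: "d \<in> projections" "d \<cdot> f = zero" "d \<squnion> e \<cdot> f = e" "e \<cdot> d = d"
    using ex_difference P by blast
  have "d = zero"
  proof (rule ccontr)
    assume "d \<noteq> zero"
    then obtain \<phi> where \<phi>: "\<phi> \<in> prime_characters" "\<phi> d"
      using ex_character d by blast
    then have "\<phi> e"
      using d P by (metis character_mul)
    with \<phi> le have "\<phi> (d \<cdot> f)"
      using d P by (metis character_mul)
    with \<phi> d show False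
      by (metis character_zero)
  qed
  then show ?thesis
    using d P by simp
qed

end

section \<open>The Stone space of prime characters\<close>

lemma openin_topology_generated_by_base:
  assumes base: "\<And>A B x. \<lbrakk>A \<in> \<S>; B \<in> \<S>; x \<in> A; x \<in> B\<rbrakk> \<Longrightarrow> \<exists>C\<in>\<S>. x \<in> C \<and> C \<subseteq> A \<inter> B"
  shows "openin (topology_generated_by \<S>) U \<longleftrightarrow> (\<forall>x\<in>U. \<exists>B\<in>\<S>. x \<in> B \<and> B \<subseteq> U)"
proof
  assume "openin (topology_generated_by \<S>) U"
  then have "generate_topology_on \<S> U"
    by (rule openin_topology_generated_by)
  then show "\<forall>x\<in>U. \<exists>B\<in>\<S>. x \<in> B \<and> B \<subseteq> U"
  proof induction
    case (Int U V)
    show ?case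
    proof
      fix x assume "x \<in> U \<inter> V"
      then obtain A B where "A \<in> \<S>" "x \<in> A" "A \<subseteq> U" "B \<in> \<S>" "x \<in> B" "B \<subseteq> V"
        using Int.IH by blast
      then show "\<exists>B\<in>\<S>. x \<in> B \<and> B \<subseteq> U \<inter> V"
        using base[of A B x] by blast
    qed
  next
    case (UN K)
    then show ?case
      by (meson UnionE Union_upper order_trans)
  qed blast+
next
  assume "\<forall>x\<in>U. \<exists>B\<in>\<S>. x \<in> B \<and> B \<subseteq> U"
  then have "U = \<Union>{B \<in> \<S>. B \<subseteq> U}"
    by blast
  moreover have "openin (topology_generated_by \<S>) (\<Union>{B \<in> \<S>. B \<subseteq> U})"
    by (intro openin_Union) (auto intro: topology_generated_by_Basis)
  ultimately show "openin (topology_generated_by \<S>) U"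
    by simp
qed

lemma continuous_map_into_discrete_combine:
  assumes "continuous_map X (discrete_topology UNIV) f" "continuous_map X (discrete_topology UNIV) g"
  shows "continuous_map X (discrete_topology UNIV) (\<lambda>x. h (f x) (g x))"
proof -
  have "continuous_map X (discrete_topology UNIV) (\<lambda>x. (f x, g x))"
    unfolding UNIV_Times_UNIV[symmetric] prod_topology_discrete_topology
    using assms by (simp add: continuous_map_paired)
  then have "continuous_map X (discrete_topology UNIV) ((\<lambda>(a, b). h a b) \<circ> (\<lambda>x. (f x, g x)))"
    by (rule continuous_map_compose) simp
  then show ?thesis
    by (simp add: o_def)
qed

context boolean_restriction_semigroup
begin

text \<open>The basic open sets \<open>D\<^sub>e\<close> of the space of characters.\<close>

definition stone_set :: "'a \<Rightarrow> ('a \<Rightarrow> bool) set" where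
  "stone_set e = {\<phi> \<in> prime_characters. \<phi> e}"

lemma mem_stone_set [simp]: "\<phi> \<in> stone_set e \<longleftrightarrow> \<phi> \<in> prime_characters \<and> \<phi> e"
  by (simp add: stone_set_def)

lemma character_space_eq: "character_space = topology_generated_by (stone_set ` projections)"
  by (simp add: character_space_def stone_set_def[abs_def])

lemma topspace_character_space [simp]: "topspace character_space = prime_characters"
  using character_nonzero by (auto simp: character_space_eq)

lemma openin_character_space_iff:
  "openin character_space U \<longleftrightarrow>
    (\<forall>\<phi>\<in>U. \<exists>e\<in>projections. \<phi> \<in> prime_characters \<and> \<phi> e \<and> stone_set e \<subseteq> U)"
proof -
  have "openin character_space U \<longleftrightarrow>
    (\<forall>\<phi>\<in>U. \<exists>B\<in>stone_set ` projections. \<phi> \<in> B \<and> B \<subseteq> U)"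
    unfolding character_space_eq
  proof (rule openin_topology_generated_by_base)
    fix A B \<phi>
    assume "A \<in> stone_set ` projections" "B \<in> stone_set ` projections" "\<phi> \<in> A" "\<phi> \<in> B"
    then obtain e f where "e \<in> projections" "A = stone_set e" "f \<in> projections" "B = stone_set f"
      by blast
    moreover from this have "stone_set (e \<cdot> f) = A \<inter> B"
      by (auto simp: character_mul)
    ultimately show "\<exists>C\<in>stone_set ` projections. \<phi> \<in> C \<and> C \<subseteq> A \<inter> B"
      using \<open>\<phi> \<in> A\<close> \<open>\<phi> \<in> B\<close> by (metis IntI image_eqI order_refl projection_mul)
  qed
  then show ?thesis
    by (auto simp: Bex_def)
qed

lemma openin_stone_set: "e \<in> projections \<Longrightarrow> openin character_space (stone_set e)"
  by (auto simp: openin_character_space_iff)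

text \<open>Each condition that defines a character positive on \<open>e\<close> constrains finitely many coordinates, so
  together they cut out a closed, hence by Tychonoff compact, subset of the product of discrete
  two-point spaces indexed by the projections. On this subset the topology generated by the sets
  \<open>D\<^sub>f\<close> is coarser than the product topology. The requirement that a character be nonzero is not a
  closed condition; it is positivity on the fixed \<open>e\<close> that ensures it.\<close>

lemma compactin_stone_set:
  assumes "e \<in> projections"
  shows "compactin character_space (stone_set e)"
proof -
  define X where "X = product_topology (\<lambda>_. discrete_topology (UNIV :: bool set)) projections"
  have topspace_X: "topspace X = extensional projections"
    by (simp add: X_def PiE_def)
  have "compact_space X"
    by (simp add: X_def compact_space_product_topology compact_space_discrete_topology)
  have coordinate: "continuous_map X (discrete_topology UNIV) (\<lambda>\<phi>. \<phi> a)" if "a \<in> projections" for a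
    using that continuous_map_product_projection[of a projections "\<lambda>_. discrete_topology UNIV"]
    by (simp add: X_def)
  have closed: "closedin X {\<phi> \<in> topspace X. Q \<phi>}"
    if "continuous_map X (discrete_topology UNIV) Q" for Q
    using closedin_continuous_map_preimage[OF that, of "{True}"] by simp
  note combine =
    continuous_map_into_discrete_combine[where X = X and h = "(\<and>)"]
    continuous_map_into_discrete_combine[where X = X and h = "(=) :: bool \<Rightarrow> bool \<Rightarrow> bool"]
    continuous_map_into_discrete_combine[where X = X and h = "(\<or>)"]
    continuous_map_into_discrete_combine[where X = X and h = "\<lambda>x y. \<not> y", OF coordinate[OF assms]]
  let ?Q = "\<lambda>(a, b) \<phi>. (\<phi> e \<and> \<not> \<phi> zero) \<and>
    (\<phi> (a \<cdot> b) \<longleftrightarrow> \<phi> a \<and> \<phi> b) \<and> (\<phi> (a \<squnion> b) \<longleftrightarrow> \<phi> a \<or> \<phi> b)"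
  have "closedin X {\<phi> \<in> topspace X. ?Q p \<phi>}" if "p \<in> projections \<times> projections" for p
  proof -
    obtain a b where p: "p = (a, b)" "a \<in> projections" "b \<in> projections"
      using \<open>p \<in> projections \<times> projections\<close> by blast
    have "closedin X {\<phi> \<in> topspace X. ?Q (a, b) \<phi>}"
      unfolding prod.case
      by (intro closed combine coordinate p assms proj_join_closed projection_mul zero_projection)
    with p show ?thesis
      by simp
  qed
  then have "closedin X (\<Inter>p\<in>projections \<times> projections. {\<phi> \<in> topspace X. ?Q p \<phi>})"
    using assms by (intro closedin_INT) auto
  moreover have "stone_set e = (\<Inter>p\<in>projections \<times> projections. {\<phi> \<in> topspace X. ?Q p \<phi>})"
    using assms by (auto simp: prime_characters_iff topspace_X intro!: bexI[of _ e])
  ultimately have "compactin X (stone_set e)"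
    using \<open>compact_space X\<close> closedin_compact_space by metis
  moreover have "continuous_map (subtopology X (stone_set e)) character_space (\<lambda>\<phi>. \<phi>)"
    unfolding character_space_eq
  proof (rule continuous_on_generated_topo)
    fix U assume "U \<in> stone_set ` projections"
    then obtain f where f: "f \<in> projections" "U = stone_set f"
      by blast
    have "openin X {\<phi> \<in> topspace X. \<phi> f}"
      using openin_continuous_map_preimage[OF coordinate[OF f(1)], of "{True}"] by simp
    moreover have "(\<lambda>\<phi>. \<phi>) -` U \<inter> topspace (subtopology X (stone_set e)) =
        {\<phi> \<in> topspace X. \<phi> f} \<inter> stone_set e"
      using f by auto
    ultimately show "openin (subtopology X (stone_set e))
        ((\<lambda>\<phi>. \<phi>) -` U \<inter> topspace (subtopology X (stone_set e)))"
      unfolding openin_subtopology by blast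
  qed (use assms in auto)
  ultimately show ?thesis
    using image_compactin[of "subtopology X (stone_set e)" "stone_set e" character_space "\<lambda>\<phi>. \<phi>"]
    by (simp add: compactin_subtopology)
qed

lemma locally_compact_character_space: "locally_compact_space character_space"
  unfolding locally_compact_space_def
proof
  fix \<phi> assume "\<phi> \<in> topspace character_space"
  then obtain e where "e \<in> projections" "\<phi> \<in> stone_set e"
    using character_nonzero by auto
  then show "\<exists>U K. openin character_space U \<and> compactin character_space K \<and> \<phi> \<in> U \<and> U \<subseteq> K"
    using compactin_stone_set openin_stone_set by blast
qed

text \<open>If \<open>\<phi> e\<close> and not \<open>\<psi> e\<close>, choose \<open>f\<close> with \<open>\<psi> f\<close>; then \<open>\<psi>\<close> is positive on the difference of \<open>f\<close>
  and \<open>e\<close>, which is disjoint from \<open>e\<close>.\<close>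

lemma Hausdorff_character_space: "Hausdorff_space character_space"
proof -
  have separate: "\<exists>a\<in>projections. \<exists>b\<in>projections. a \<cdot> b = zero \<and> \<phi> a \<and> \<psi> b"
    if \<phi>: "\<phi> \<in> prime_characters" and \<psi>: "\<psi> \<in> prime_characters"
      and e: "e \<in> projections" "\<phi> e" "\<not> \<psi> e" for \<phi> \<psi> e
  proof -
    obtain f where f: "f \<in> projections" "\<psi> f"
      using character_nonzero \<psi> by blast
    obtain d where d: "d \<in> projections" "d \<cdot> e = zero" "d \<squnion> f \<cdot> e = f"
      using ex_difference f e by blast
    then have "\<psi> d"
      using \<psi> e f by (metis character_join character_mul projection_mul)
    with d e show ?thesis
      by (metis projection_commute)
  qed
  have disjoint: "disjnt (stone_set a) (stone_set b)"
    if "a \<in> projections" "b \<in> projections" "a \<cdot> b = zero" for a b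
    using that unfolding disjnt_iff mem_stone_set by (metis character_mul character_zero)
  show ?thesis
    unfolding Hausdorff_space_def topspace_character_space
  proof (intro allI impI, elim conjE)
    fix \<phi> \<psi> assume \<phi>\<psi>: "\<phi> \<in> prime_characters" "\<psi> \<in> prime_characters" "\<phi> \<noteq> \<psi>"
    then obtain e where "e \<in> projections" "\<phi> e \<noteq> \<psi> e"
      using character_eqI by blast
    then obtain a b where "a \<in> projections" "b \<in> projections" "a \<cdot> b = zero" "\<phi> a" "\<psi> b"
    proof (cases "\<phi> e")
      case True
      then show thesis
        using separate[of \<phi> \<psi> e] \<phi>\<psi> \<open>e \<in> projections\<close> \<open>\<phi> e \<noteq> \<psi> e\<close> that by auto
    next
      case False
      then obtain a b where "a \<in> projections" "b \<in> projections" "a \<cdot> b = zero" "\<psi> a" "\<phi> b"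
        using separate[of \<psi> \<phi> e] \<phi>\<psi> \<open>e \<in> projections\<close> \<open>\<phi> e \<noteq> \<psi> e\<close> by auto
      then show thesis
        using that[of b a] by (simp add: projection_commute)
    qed
    then show "\<exists>U V. openin character_space U \<and> openin character_space V \<and>
        \<phi> \<in> U \<and> \<psi> \<in> V \<and> disjnt U V"
      using disjoint[of a b] openin_stone_set[of a] openin_stone_set[of b] \<phi>\<psi>
      by (intro exI[of _ "stone_set a"] exI[of _ "stone_set b"]) simp
  qed
qed

text \<open>The sets \<open>D\<^sub>e\<close> form a basis closed under finite unions, since \<open>D\<^sub>e \<union> D\<^sub>f = D\<^bsub>e \<squnion> f\<^esub>\<close> and
  \<open>D\<^sub>0\<close> is empty.\<close>

lemma compact_open_eq_stone_set:
  assumes "compactin character_space U" "openin character_space U"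
  obtains e where "e \<in> projections" "U = stone_set e"
proof -
  let ?\<B> = "{stone_set e |e. e \<in> projections \<and> stone_set e \<subseteq> U}"
  have "U \<subseteq> \<Union>?\<B>"
  proof
    fix \<phi> assume "\<phi> \<in> U"
    then obtain e where "e \<in> projections" "\<phi> \<in> prime_characters" "\<phi> e" "stone_set e \<subseteq> U"
      using assms(2) unfolding openin_character_space_iff by blast
    then show "\<phi> \<in> \<Union>?\<B>"
      by (intro UnionI[of "stone_set e"]) auto
  qed
  moreover have "\<forall>B\<in>?\<B>. openin character_space B"
    using openin_stone_set by blast
  ultimately obtain \<F> where \<F>: "finite \<F>" "\<F> \<subseteq> ?\<B>" "U \<subseteq> \<Union>\<F>"
    using assms(1) unfolding compactin_def by meson
  have "\<exists>e\<in>projections. \<Union>\<F> = stone_set e"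
    using \<F>(1,2)
  proof (induction \<F> rule: finite_induct)
    case empty
    have "stone_set zero = {}"
      by (auto simp: character_zero)
    then show ?case
      using zero_projection by auto
  next
    case (insert B \<F>)
    then obtain e f where "e \<in> projections" "\<Union>\<F> = stone_set e" "f \<in> projections" "B = stone_set f"
      by auto
    then have "\<Union>(insert B \<F>) = stone_set (f \<squnion> e)"
      by (auto simp: character_join)
    with \<open>e \<in> projections\<close> \<open>f \<in> projections\<close> show ?case
      using proj_join_closed by blast
  qed
  moreover have "\<Union>\<F> = U"
    using \<F> by blast
  ultimately show thesis
    using that by blast
qed

lemma stone_set_subset_iff:
  assumes "e \<in> projections" "f \<in> projections"
  shows "stone_set e \<subseteq> stone_set f \<longleftrightarrow> e \<cdot> f = e"
proof
  assume "stone_set e \<subseteq> stone_set f"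
  then show "e \<cdot> f = e"
    using assms by (intro projection_le_if_characters_le) auto
next
  assume "e \<cdot> f = e"
  then show "stone_set e \<subseteq> stone_set f"
    using character_mul assms by (metis mem_stone_set subsetI)
qed

end

section \<open>The space of germs\<close>

context boolean_restriction_semigroup
begin

lemma act_apply [simp]: "e \<in> projections \<Longrightarrow> act s \<phi> e = \<phi> ((e \<cdot> s)\<^sup>\<star>)"
  by (simp add: act_def)

lemma act_extensional: "act s \<phi> \<in> extensional projections"
  by (simp add: act_def)

lemma act_projection:
  assumes "\<phi> \<in> prime_characters" "e \<in> projections" "\<phi> e"
  shows "act e \<phi> = \<phi>"
  by (rule extensionalityI[OF act_extensional character_extensional])
    (use assms in \<open>simp_all add: character_mul\<close>)

lemma act_mul: "act (s \<cdot> t) \<phi> = act s (act t \<phi>)"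
proof (rule extensionalityI[OF act_extensional act_extensional])
  fix e assume "e \<in> projections"
  moreover have "((e \<cdot> s)\<^sup>\<star> \<cdot> t)\<^sup>\<star> = (e \<cdot> (s \<cdot> t))\<^sup>\<star>"
    by (metis assoc star_mul)
  ultimately show "act (s \<cdot> t) \<phi> e = act s (act t \<phi>) e"
    by simp
qed

lemma act_le:
  assumes "\<phi> \<in> prime_characters" "u \<preceq> s" "\<phi> (u\<^sup>\<star>)"
  shows "act u \<phi> = act s \<phi>"
proof (rule extensionalityI[OF act_extensional act_extensional])
  fix e assume "e \<in> projections"
  moreover have "(e \<cdot> u)\<^sup>\<star> = (e \<cdot> s)\<^sup>\<star> \<cdot> u\<^sup>\<star>"
    using assms(2) by (metis assoc natural_le_def star_mul_projection star_projection)
  ultimately show "act u \<phi> e = act s \<phi> e"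
    using assms by (simp add: character_mul)
qed

lemma mem_germ_pairs [simp]: "(s, \<phi>) \<in> germ_pairs \<longleftrightarrow> \<phi> \<in> prime_characters \<and> \<phi> (s\<^sup>\<star>)"
  by (simp add: germ_pairs_def)

text \<open>Two elements below the same \<open>t\<close> are compatible and have the meet \<open>u \<cdot> v\<^sup>\<star>\<close>, whose domain is the meet of
  their domains. This makes the germ relation transitive.\<close>

lemma common_lower_bound:
  assumes "\<phi> \<in> prime_characters" "u \<preceq> t" "v \<preceq> t" "\<phi> (u\<^sup>\<star>)" "\<phi> (v\<^sup>\<star>)"
  shows "\<exists>w. w \<preceq> u \<and> w \<preceq> v \<and> \<phi> (w\<^sup>\<star>)"
proof (intro exI conjI)
  have "u \<cdot> v\<^sup>\<star> = v \<cdot> u\<^sup>\<star>"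
    using assms(2,3) unfolding natural_le_def by (metis (no_types) assoc star_commute)
  then show "u \<cdot> v\<^sup>\<star> \<preceq> u" "u \<cdot> v\<^sup>\<star> \<preceq> v"
    by (metis mul_projection_le star_projection)+
  show "\<phi> ((u \<cdot> v\<^sup>\<star>)\<^sup>\<star>)"
    using assms by (simp add: star_mul_projection character_mul)
qed

lemma mem_germ_rel:
  "((s, \<phi>), (t, \<psi>)) \<in> germ_rel \<longleftrightarrow>
    \<phi> \<in> prime_characters \<and> \<psi> = \<phi> \<and> (\<exists>u. u \<preceq> s \<and> u \<preceq> t \<and> \<phi> (u\<^sup>\<star>))"
  using character_mono by (auto simp: germ_rel_def)

lemma equiv_germ_rel: "equiv germ_pairs germ_rel"
proof (rule equivI)
  show "germ_rel \<subseteq> germ_pairs \<times> germ_pairs"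
    by (auto simp: germ_rel_def)
  show "refl_on germ_pairs germ_rel"
    unfolding refl_on_def by (clarsimp simp: mem_germ_rel) (metis natural_le_refl)
  show "sym germ_rel"
    by (auto simp: sym_def mem_germ_rel)
  show "trans germ_rel"
  proof (rule transI)
    fix x y z assume "(x, y) \<in> germ_rel" "(y, z) \<in> germ_rel"
    moreover obtain s \<phi> t \<psi> r \<eta> where "x = (s, \<phi>)" "y = (t, \<psi>)" "z = (r, \<eta>)"
      by (metis surj_pair)
    ultimately obtain u v where uv: "\<phi> \<in> prime_characters" "\<psi> = \<phi>" "\<eta> = \<phi>"
        "u \<preceq> s" "u \<preceq> t" "\<phi> (u\<^sup>\<star>)" "v \<preceq> t" "v \<preceq> r" "\<phi> (v\<^sup>\<star>)"
      by (auto simp: mem_germ_rel)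
    then obtain w where "w \<preceq> u" "w \<preceq> v" "\<phi> (w\<^sup>\<star>)"
      using common_lower_bound by blast
    then have "w \<preceq> s" "w \<preceq> r"
      using uv natural_le_trans by blast+
    with \<open>\<phi> (w\<^sup>\<star>)\<close> uv show "(x, z) \<in> germ_rel"
      unfolding \<open>x = (s, \<phi>)\<close> \<open>z = (r, \<eta>)\<close> mem_germ_rel by blast
  qed
qed

lemma germ_eq_iff:
  assumes "\<phi> \<in> prime_characters" "\<phi> (s\<^sup>\<star>)" "\<psi> \<in> prime_characters" "\<psi> (t\<^sup>\<star>)"
  shows "germ s \<phi> = germ t \<psi> \<longleftrightarrow> \<psi> = \<phi> \<and> (\<exists>u. u \<preceq> s \<and> u \<preceq> t \<and> \<phi> (u\<^sup>\<star>))"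
  using eq_equiv_class_iff[OF equiv_germ_rel, of "(s, \<phi>)" "(t, \<psi>)"] assms
  by (simp add: germ_def mem_germ_rel)

lemma germ_le:
  assumes "\<phi> \<in> prime_characters" "u \<preceq> s" "\<phi> (u\<^sup>\<star>)"
  shows "germ u \<phi> = germ s \<phi>"
  using assms character_mono natural_le_refl by (subst germ_eq_iff) blast+

lemma germ_dom_germ [simp]:
  assumes "\<phi> \<in> prime_characters" "\<phi> (s\<^sup>\<star>)" shows "germ_dom (germ s \<phi>) = \<phi>"
  unfolding germ_dom_def by (rule the_equality) (use assms germ_eq_iff in auto)

lemma germ_ran_germ [simp]:
  assumes "\<phi> \<in> prime_characters" "\<phi> (s\<^sup>\<star>)" shows "germ_ran (germ s \<phi>) = act s \<phi>"
  unfolding germ_ran_def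
proof (rule the_equality)
  show "\<exists>t \<psi>. (t, \<psi>) \<in> germ_pairs \<and> germ s \<phi> = germ t \<psi> \<and> act s \<phi> = act t \<psi>"
    using assms by auto
next
  fix \<eta> assume "\<exists>t \<psi>. (t, \<psi>) \<in> germ_pairs \<and> germ s \<phi> = germ t \<psi> \<and> \<eta> = act t \<psi>"
  then obtain t u where "u \<preceq> s" "u \<preceq> t" "\<phi> (u\<^sup>\<star>)" "\<eta> = act t \<phi>"
    using germ_eq_iff assms by auto
  then show "\<eta> = act s \<phi>"
    using act_le assms by metis
qed

lemma germ_unit_eq:
  assumes "\<phi> \<in> prime_characters" "e \<in> projections" "\<phi> e"
  shows "germ_unit \<phi> = germ e \<phi>"
  unfolding germ_unit_def
proof (rule the_equality)
  fix x assume "\<exists>f\<in>projections. \<phi> f \<and> x = germ f \<phi>"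
  then obtain f where f: "f \<in> projections" "\<phi> f" "x = germ f \<phi>"
    by blast
  have "germ (e \<cdot> f) \<phi> = germ e \<phi>" "germ (e \<cdot> f) \<phi> = germ f \<phi>"
    by (rule germ_le; use assms f in \<open>simp add: mul_projection_le projection_mul_le character_mul\<close>)+
  with f show "x = germ e \<phi>"
    by simp
qed (use assms in blast)

text \<open>Representatives are exchanged through common lower bounds: if \<open>u\<close> is below both representatives
  of the first factor applied and \<open>v\<close> below both of the second, then \<open>v \<cdot> u\<close> is below both products,
  and \<open>\<psi>\<close> is positive on the domain of \<open>v \<cdot> u\<close> because \<open>u\<close> and \<open>t\<close> act equally on \<open>\<psi>\<close>.\<close>

lemma germ_mult_germ:
  assumes \<psi>: "\<psi> \<in> prime_characters" "\<psi> (t\<^sup>\<star>)" and act: "act t \<psi> \<in> prime_characters" "act t \<psi> (s\<^sup>\<star>)"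
  shows "germ_mult (germ s (act t \<psi>)) (germ t \<psi>) = germ (s \<cdot> t) \<psi>"
  unfolding germ_mult_def
proof (rule the_equality)
  show "\<exists>s' t' \<psi>'. (t', \<psi>') \<in> germ_pairs \<and> (s', act t' \<psi>') \<in> germ_pairs \<and>
      germ s (act t \<psi>) = germ s' (act t' \<psi>') \<and> germ t \<psi> = germ t' \<psi>' \<and>
      germ (s \<cdot> t) \<psi> = germ (s' \<cdot> t') \<psi>'"
    by (intro exI[of _ s] exI[of _ t] exI[of _ \<psi>]) (use assms in simp)
next
  fix z
  assume "\<exists>s' t' \<psi>'. (t', \<psi>') \<in> germ_pairs \<and> (s', act t' \<psi>') \<in> germ_pairs \<and>
      germ s (act t \<psi>) = germ s' (act t' \<psi>') \<and> germ t \<psi> = germ t' \<psi>' \<and> z = germ (s' \<cdot> t') \<psi>'"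
  then obtain s' t' \<psi>' where *: "\<psi>' \<in> prime_characters" "\<psi>' (t'\<^sup>\<star>)"
      "act t' \<psi>' \<in> prime_characters" "act t' \<psi>' (s'\<^sup>\<star>)"
      "germ s (act t \<psi>) = germ s' (act t' \<psi>')" "germ t \<psi> = germ t' \<psi>'" "z = germ (s' \<cdot> t') \<psi>'"
    unfolding mem_germ_pairs by blast
  obtain u where u: "\<psi>' = \<psi>" "u \<preceq> t" "u \<preceq> t'" "\<psi> (u\<^sup>\<star>)"
    using * \<psi> germ_eq_iff by metis
  obtain v where v: "v \<preceq> s" "v \<preceq> s'" "act t \<psi> (v\<^sup>\<star>)"
    using * act germ_eq_iff by metis
  have "act u \<psi> (v\<^sup>\<star>)"
    using v act_le \<psi> u by metis
  then have "\<psi> ((v \<cdot> u)\<^sup>\<star>)"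
    by (simp flip: star_mul)
  moreover have "v \<cdot> u \<preceq> s \<cdot> t" "v \<cdot> u \<preceq> s' \<cdot> t'"
    using u v mul_mono by blast+
  ultimately show "z = germ (s \<cdot> t) \<psi>"
    using germ_le \<psi> *(7) u(1) by metis
qed

lemma germ_slice_eq: "germ_slice s = (germ s) ` stone_set (s\<^sup>\<star>)"
  by (auto simp: germ_slice_def)

lemma germ_in_germ_slice_iff:
  assumes "\<phi> \<in> prime_characters" "\<phi> (t\<^sup>\<star>)"
  shows "germ t \<phi> \<in> germ_slice s \<longleftrightarrow> (\<exists>u. u \<preceq> s \<and> u \<preceq> t \<and> \<phi> (u\<^sup>\<star>))"
proof
  assume "germ t \<phi> \<in> germ_slice s"
  then show "\<exists>u. u \<preceq> s \<and> u \<preceq> t \<and> \<phi> (u\<^sup>\<star>)"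
    using assms germ_eq_iff by (auto simp: germ_slice_eq)
next
  assume "\<exists>u. u \<preceq> s \<and> u \<preceq> t \<and> \<phi> (u\<^sup>\<star>)"
  then obtain u where u: "u \<preceq> s" "u \<preceq> t" "\<phi> (u\<^sup>\<star>)"
    by blast
  then have "germ t \<phi> = germ s \<phi>"
    using germ_le assms by metis
  moreover have "\<phi> (s\<^sup>\<star>)"
    using u character_mono assms by blast
  ultimately show "germ t \<phi> \<in> germ_slice s"
    using assms by (simp add: germ_slice_eq)
qed

lemma germ_slice_mono:
  assumes "u \<preceq> s" shows "germ_slice u \<subseteq> germ_slice s"
proof
  fix x assume "x \<in> germ_slice u"
  then obtain \<phi> where "\<phi> \<in> prime_characters" "\<phi> (u\<^sup>\<star>)" "x = germ u \<phi>"
    by (auto simp: germ_slice_eq)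
  then show "x \<in> germ_slice s"
    using assms natural_le_refl germ_in_germ_slice_iff by blast
qed

lemma germ_cases:
  assumes "x \<in> topspace germ_space"
  obtains s \<phi> where "\<phi> \<in> prime_characters" "\<phi> (s\<^sup>\<star>)" "x = germ s \<phi>"
  using assms that by (auto simp: germ_space_def germ_slice_eq)

lemma openin_germ_slice: "openin germ_space (germ_slice s)"
  by (simp add: germ_space_def topology_generated_by_Basis)

lemma germ_in_topspace [simp]:
  "\<lbrakk>\<phi> \<in> prime_characters; \<phi> (s\<^sup>\<star>)\<rbrakk> \<Longrightarrow> germ s \<phi> \<in> topspace germ_space"
  by (auto simp: germ_space_def germ_slice_eq intro!: exI[of _ s])

lemma openin_germ_space_iff:
  "openin germ_space U \<longleftrightarrow> (\<forall>x\<in>U. \<exists>s. x \<in> germ_slice s \<and> germ_slice s \<subseteq> U)"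
proof -
  have "openin germ_space U \<longleftrightarrow> (\<forall>x\<in>U. \<exists>B\<in>range germ_slice. x \<in> B \<and> B \<subseteq> U)"
    unfolding germ_space_def
  proof (rule openin_topology_generated_by_base)
    fix A B x
    assume "A \<in> range germ_slice" "B \<in> range germ_slice" "x \<in> A" "x \<in> B"
    then obtain s t \<phi> where AB: "A = germ_slice s" "B = germ_slice t"
        and \<phi>: "\<phi> \<in> prime_characters" "\<phi> (s\<^sup>\<star>)" "x = germ s \<phi>"
      by (auto simp: germ_slice_eq)
    with \<open>x \<in> B\<close> obtain u where u: "u \<preceq> s" "u \<preceq> t" "\<phi> (u\<^sup>\<star>)"
      using germ_in_germ_slice_iff by blast
    then have "x \<in> germ_slice u"
      using \<phi> natural_le_refl germ_in_germ_slice_iff by blast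
    with u AB show "\<exists>C\<in>range germ_slice. x \<in> C \<and> C \<subseteq> A \<inter> B"
      using germ_slice_mono by blast
  qed
  then show ?thesis
    by simp
qed

lemma germ_in_own_slice: "\<lbrakk>\<phi> \<in> prime_characters; \<phi> (s\<^sup>\<star>)\<rbrakk> \<Longrightarrow> germ s \<phi> \<in> germ_slice s"
  by (simp add: germ_slice_eq)

text \<open>An open neighbourhood of \<open>[s, \<phi>]\<close> may always be sought among the slices of elements below \<open>s\<close>.\<close>

lemma openin_germ_spaceI:
  assumes "U \<subseteq> topspace germ_space"
    and "\<And>s \<phi>. \<lbrakk>\<phi> \<in> prime_characters; \<phi> (s\<^sup>\<star>); germ s \<phi> \<in> U\<rbrakk>
      \<Longrightarrow> \<exists>u. u \<preceq> s \<and> \<phi> (u\<^sup>\<star>) \<and> germ_slice u \<subseteq> U"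
  shows "openin germ_space U"
  unfolding openin_germ_space_iff
proof
  fix x assume "x \<in> U"
  then obtain s \<phi> where x: "\<phi> \<in> prime_characters" "\<phi> (s\<^sup>\<star>)" "x = germ s \<phi>"
    using germ_cases assms(1) by blast
  then obtain u where u: "u \<preceq> s" "\<phi> (u\<^sup>\<star>)" "germ_slice u \<subseteq> U"
    using assms(2) \<open>x \<in> U\<close> by blast
  then have "x \<in> germ_slice u"
    using x germ_le germ_in_own_slice by metis
  with u show "\<exists>s. x \<in> germ_slice s \<and> germ_slice s \<subseteq> U"
    by blast
qed

lemma continuous_germ_dom: "continuous_map germ_space character_space germ_dom"
  unfolding character_space_eq
proof (rule continuous_on_generated_topo)
  fix U assume "U \<in> stone_set ` projections"
  then obtain e where e: "e \<in> projections" "U = stone_set e"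
    by blast
  show "openin germ_space (germ_dom -` U \<inter> topspace germ_space)"
  proof (rule openin_germ_spaceI)
    fix s \<phi> assume \<phi>: "\<phi> \<in> prime_characters" "\<phi> (s\<^sup>\<star>)" "germ s \<phi> \<in> germ_dom -` U \<inter> topspace germ_space"
    have "germ_slice (s \<cdot> e) \<subseteq> germ_dom -` U \<inter> topspace germ_space"
      using e by (auto simp: germ_slice_eq star_mul_projection character_mul)
    moreover have "\<phi> ((s \<cdot> e)\<^sup>\<star>)"
      using \<phi> e by (simp add: star_mul_projection character_mul)
    ultimately show "\<exists>u. u \<preceq> s \<and> \<phi> (u\<^sup>\<star>) \<and> germ_slice u \<subseteq> germ_dom -` U \<inter> topspace germ_space"
      using e mul_projection_le by blast
  qed simp
next
  show "germ_dom ` topspace germ_space \<subseteq> \<Union> (stone_set ` projections)"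
    by (auto elim!: germ_cases intro!: exI bexI[OF _ star_projection])
qed

lemma germ_dom_germ_slice: "germ_dom ` germ_slice s = stone_set (s\<^sup>\<star>)"
  by (force simp: germ_slice_eq image_image)

lemma germ_ran_germ_slice: "germ_ran ` germ_slice s = act s ` stone_set (s\<^sup>\<star>)"
  by (force simp: germ_slice_eq image_image)

lemma inj_on_germ_dom: "inj_on germ_dom (germ_slice s)"
  by (auto simp: inj_on_def germ_slice_eq)

lemma open_germ_dom: "open_map germ_space character_space germ_dom"
  unfolding open_map_def openin_character_space_iff
proof (intro allI impI ballI)
  fix U \<phi> assume U: "openin germ_space U" and "\<phi> \<in> germ_dom ` U"
  then obtain x s where x: "x \<in> U" "\<phi> = germ_dom x" "x \<in> germ_slice s" "germ_slice s \<subseteq> U"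
    unfolding openin_germ_space_iff by blast
  then have "\<phi> \<in> stone_set (s\<^sup>\<star>)" "stone_set (s\<^sup>\<star>) \<subseteq> germ_dom ` U"
    by (auto simp flip: germ_dom_germ_slice)
  then show "\<exists>e\<in>projections. \<phi> \<in> prime_characters \<and> \<phi> e \<and> stone_set e \<subseteq> germ_dom ` U"
    by (metis mem_stone_set star_projection)
qed

text \<open>The domain map restricts to a homeomorphism from \<open>\<Theta>(s)\<close> onto the compact set \<open>D\<^bsub>s\<^sup>\<star>\<^esub>\<close>;
  compactness is transported along its inverse \<open>\<phi> \<mapsto> [s, \<phi>]\<close>.\<close>

lemma compactin_germ_slice: "compactin germ_space (germ_slice s)"
proof -
  have "continuous_map (subtopology character_space (stone_set (s\<^sup>\<star>))) germ_space (germ s)"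
    unfolding germ_space_def
  proof (rule continuous_on_generated_topo)
    fix U assume "U \<in> range germ_slice"
    then obtain t where t: "U = germ_slice t"
      by blast
    let ?V = "germ s -` U \<inter> stone_set (s\<^sup>\<star>)"
    have "openin character_space ?V"
      unfolding openin_character_space_iff
    proof
      fix \<phi> assume "\<phi> \<in> ?V"
      then obtain u where u: "\<phi> \<in> prime_characters" "u \<preceq> t" "u \<preceq> s" "\<phi> (u\<^sup>\<star>)"
        using germ_in_germ_slice_iff t by auto
      have "stone_set (u\<^sup>\<star>) \<subseteq> ?V"
      proof
        fix \<psi> assume "\<psi> \<in> stone_set (u\<^sup>\<star>)"
        then have \<psi>: "\<psi> \<in> prime_characters" "\<psi> (u\<^sup>\<star>)"
          by simp_all
        then have "\<psi> (s\<^sup>\<star>)"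
          using character_mono u(3) by blast
        then show "\<psi> \<in> ?V"
          using \<psi> u t germ_in_germ_slice_iff by auto
      qed
      with u show "\<exists>e\<in>projections. \<phi> \<in> prime_characters \<and> \<phi> e \<and> stone_set e \<subseteq> ?V"
        using star_projection by blast
    qed
    then show "openin (subtopology character_space (stone_set (s\<^sup>\<star>)))
        (germ s -` U \<inter> topspace (subtopology character_space (stone_set (s\<^sup>\<star>))))"
      unfolding openin_subtopology by (intro exI[of _ ?V]) auto
  next
    show "germ s ` topspace (subtopology character_space (stone_set (s\<^sup>\<star>))) \<subseteq> \<Union> (range germ_slice)"
      by (auto simp: germ_slice_eq)
  qed
  moreover have "compactin (subtopology character_space (stone_set (s\<^sup>\<star>))) (stone_set (s\<^sup>\<star>))"
    by (simp add: compactin_subtopology compactin_stone_set)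
  ultimately show ?thesis
    unfolding germ_slice_eq by (rule image_compactin[rotated])
qed

lemma local_homeomorphism_germ_dom: "local_homeomorphism germ_space character_space germ_dom"
  unfolding local_homeomorphism_def
proof
  fix x assume "x \<in> topspace germ_space"
  then obtain s where s: "x \<in> germ_slice s"
    by (auto simp: germ_space_def)
  have sub: "germ_slice s \<subseteq> topspace germ_space"
    by (simp add: openin_germ_slice openin_subset)
  have "openin character_space (germ_dom ` germ_slice s)"
    using open_germ_dom openin_germ_slice by (simp add: open_map_def)
  moreover have "homeomorphic_map (subtopology germ_space (germ_slice s))
      (subtopology character_space (germ_dom ` germ_slice s)) germ_dom"
  proof (rule bijective_open_imp_homeomorphic_map)
    show "continuous_map (subtopology germ_space (germ_slice s))
        (subtopology character_space (germ_dom ` germ_slice s)) germ_dom"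
      using continuous_germ_dom sub
      by (auto simp: continuous_map_in_subtopology continuous_map_from_subtopology)
    show "open_map (subtopology germ_space (germ_slice s))
        (subtopology character_space (germ_dom ` germ_slice s)) germ_dom"
      using open_germ_dom openin_germ_slice
      by (intro open_map_into_subtopology open_map_from_subtopology) auto
    show "germ_dom ` topspace (subtopology germ_space (germ_slice s)) =
        topspace (subtopology character_space (germ_dom ` germ_slice s))"
      using sub openin_subset[OF \<open>openin character_space (germ_dom ` germ_slice s)\<close>]
      by (simp add: Int_absorb1)
    show "inj_on germ_dom (topspace (subtopology germ_space (germ_slice s)))"
      by (rule inj_on_subset[OF inj_on_germ_dom[of s]]) simp
  qed
  ultimately show "\<exists>U. openin germ_space U \<and> x \<in> U \<and> openin character_space (germ_dom ` U) \<and>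
      homeomorphic_map (subtopology germ_space U) (subtopology character_space (germ_dom ` U)) germ_dom"
    using s openin_germ_slice by blast
qed

text \<open>Every element below a projection is a projection, so units meet \<open>\<Theta>(s)\<close> only through the
  projections below \<open>s\<close>.\<close>

lemma germ_unit_in_slice_iff:
  assumes \<phi>: "\<phi> \<in> prime_characters"
  shows "germ_unit \<phi> \<in> germ_slice s \<longleftrightarrow> (\<exists>u\<in>projections. u \<preceq> s \<and> \<phi> u)"
proof -
  obtain e where e: "e \<in> projections" "\<phi> e"
    using character_nonzero \<phi> by blast
  have "germ_unit \<phi> \<in> germ_slice s \<longleftrightarrow> (\<exists>u. u \<preceq> s \<and> u \<preceq> e \<and> \<phi> (u\<^sup>\<star>))"
    using e \<phi> by (simp add: germ_unit_eq germ_in_germ_slice_iff)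
  also have "\<dots> \<longleftrightarrow> (\<exists>u\<in>projections. u \<preceq> s \<and> \<phi> u)"
  proof
    assume "\<exists>u. u \<preceq> s \<and> u \<preceq> e \<and> \<phi> (u\<^sup>\<star>)"
    then show "\<exists>u\<in>projections. u \<preceq> s \<and> \<phi> u"
      using le_projection e(1) by (metis projection_star)
  next
    assume "\<exists>u\<in>projections. u \<preceq> s \<and> \<phi> u"
    then obtain u where u: "u \<in> projections" "u \<preceq> s" "\<phi> u"
      by blast
    then have "u \<cdot> e \<preceq> s" "u \<cdot> e \<preceq> e" "\<phi> ((u \<cdot> e)\<^sup>\<star>)"
      using \<phi> e mul_projection_le natural_le_trans projection_mul_le by (blast, blast, simp add: character_mul)
    then show "\<exists>u. u \<preceq> s \<and> u \<preceq> e \<and> \<phi> (u\<^sup>\<star>)"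
      by blast
  qed
  finally show ?thesis .
qed

lemma continuous_germ_unit: "continuous_map character_space germ_space germ_unit"
  unfolding germ_space_def
proof (rule continuous_on_generated_topo)
  fix U assume "U \<in> range germ_slice"
  then obtain s where s: "U = germ_slice s"
    by blast
  show "openin character_space (germ_unit -` U \<inter> topspace character_space)"
    unfolding openin_character_space_iff
  proof
    fix \<phi> assume "\<phi> \<in> germ_unit -` U \<inter> topspace character_space"
    then obtain u where u: "\<phi> \<in> prime_characters" "u \<in> projections" "u \<preceq> s" "\<phi> u"
      using germ_unit_in_slice_iff s by auto
    moreover from this have "stone_set u \<subseteq> germ_unit -` U \<inter> topspace character_space"
      using germ_unit_in_slice_iff s by auto
    ultimately show "\<exists>e\<in>projections. \<phi> \<in> prime_characters \<and> \<phi> e \<and>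
        stone_set e \<subseteq> germ_unit -` U \<inter> topspace character_space"
      by blast
  qed
next
  have "germ_unit \<phi> \<in> \<Union> (range germ_slice)" if \<phi>: "\<phi> \<in> prime_characters" for \<phi>
  proof -
    obtain e where "e \<in> projections" "\<phi> e"
      using character_nonzero \<phi> by blast
    then have "germ_unit \<phi> \<in> germ_slice e"
      using germ_unit_in_slice_iff \<phi> natural_le_refl by blast
    then show ?thesis
      by blast
  qed
  then show "germ_unit ` topspace character_space \<subseteq> \<Union> (range germ_slice)"
    by auto
qed

end

section \<open>The category of germs\<close>

locale boolean_semigroup_with_local_units = boolean_restriction_semigroup mul star zero
  for mul :: "'a \<Rightarrow> 'a \<Rightarrow> 'a" (infixl \<open>\<cdot>\<close> 70)
    and star :: "'a \<Rightarrow> 'a" (\<open>_\<^sup>\<star>\<close> [1000] 1000)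
    and zero :: 'a +
  assumes local_units: "has_local_units"

context boolean_semigroup_with_local_units
begin

text \<open>A local unit of \<open>s\<close> is a projection on which \<open>s \<circ> \<phi>\<close> is positive; without it \<open>s \<circ> \<phi>\<close> could be
  the zero morphism.\<close>

lemma act_in_prime_characters:
  assumes \<phi>: "\<phi> \<in> prime_characters" "\<phi> (s\<^sup>\<star>)"
  shows "act s \<phi> \<in> prime_characters"
proof -
  obtain e where "e \<in> projections" "e \<cdot> s = s"
    using local_units unfolding has_local_units_def by blast
  then have "\<exists>e\<in>projections. act s \<phi> e"
    using \<phi> by (metis act_apply)
  moreover have "\<not> act s \<phi> zero"
    using \<phi> by (simp add: character_zero)
  ultimately show ?thesis
    using \<phi> unfolding prime_characters_iff[of "act s \<phi>"]
    by (auto simp: act_extensional star_projection_mul_mul star_proj_join_mul character_mul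
        character_join)
qed

lemma continuous_germ_ran: "continuous_map germ_space character_space germ_ran"
  unfolding character_space_eq
proof (rule continuous_on_generated_topo)
  fix U assume "U \<in> stone_set ` projections"
  then obtain e where e: "e \<in> projections" "U = stone_set e"
    by blast
  show "openin germ_space (germ_ran -` U \<inter> topspace germ_space)"
  proof (rule openin_germ_spaceI)
    fix s \<phi> assume \<phi>: "\<phi> \<in> prime_characters" "\<phi> (s\<^sup>\<star>)" "germ s \<phi> \<in> germ_ran -` U \<inter> topspace germ_space"
    have "germ_slice (e \<cdot> s) \<subseteq> germ_ran -` U \<inter> topspace germ_space"
      using e by (auto simp: germ_slice_eq act_in_prime_characters)
    moreover have "\<phi> ((e \<cdot> s)\<^sup>\<star>)"
      using \<phi> e by simp
    ultimately show "\<exists>u. u \<preceq> s \<and> \<phi> (u\<^sup>\<star>) \<and> germ_slice u \<subseteq> germ_ran -` U \<inter> topspace germ_space"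
      using e projection_mul_le by blast
  qed simp
next
  have "act s \<phi> \<in> \<Union> (stone_set ` projections)"
    if "\<phi> \<in> prime_characters" "\<phi> (s\<^sup>\<star>)" for s \<phi>
    using act_in_prime_characters[OF that] character_nonzero[of "act s \<phi>"]
    by (auto simp del: act_apply)
  then show "germ_ran ` topspace germ_space \<subseteq> \<Union> (stone_set ` projections)"
    by (auto elim!: germ_cases)
qed

lemma germ_category_simps [simp]:
  "cat_obj germ_category = character_space" "cat_arr germ_category = germ_space"
  "cat_dom germ_category = germ_dom" "cat_ran germ_category = germ_ran"
  "cat_unit germ_category = germ_unit" "cat_mult germ_category = germ_mult"
  by (simp_all add: germ_category_def)

lemma mem_composable_space [simp]:
  "(x, y) \<in> topspace (composable_space germ_category) \<longleftrightarrow>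
    x \<in> topspace germ_space \<and> y \<in> topspace germ_space \<and> germ_dom x = germ_ran y"
  by (auto simp: composable_space_def)

lemma composable_cases:
  assumes "x \<in> topspace germ_space" "y \<in> topspace germ_space" "germ_dom x = germ_ran y"
  obtains s t \<psi> where "\<psi> \<in> prime_characters" "\<psi> (t\<^sup>\<star>)" "act t \<psi> \<in> prime_characters"
    "\<psi> ((s \<cdot> t)\<^sup>\<star>)" "x = germ s (act t \<psi>)" "y = germ t \<psi>"
proof -
  obtain s \<phi> where x: "\<phi> \<in> prime_characters" "\<phi> (s\<^sup>\<star>)" "x = germ s \<phi>"
    using germ_cases assms(1) by blast
  obtain t \<psi> where y: "\<psi> \<in> prime_characters" "\<psi> (t\<^sup>\<star>)" "y = germ t \<psi>"
    using germ_cases assms(2) by blast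
  have \<phi>: "\<phi> = act t \<psi>"
    using assms(3) x y by simp
  moreover from this have "\<psi> ((s \<cdot> t)\<^sup>\<star>)"
    using x(2) by (simp flip: star_mul)
  ultimately show thesis
    using that x y by blast
qed

lemma germ_mult_eq:
  assumes "\<psi> \<in> prime_characters" "\<psi> (t\<^sup>\<star>)" "\<psi> ((s \<cdot> t)\<^sup>\<star>)"
  shows "germ_mult (germ s (act t \<psi>)) (germ t \<psi>) = germ (s \<cdot> t) \<psi>"
  using assms act_in_prime_characters by (intro germ_mult_germ) (simp_all flip: star_mul)

text \<open>Suppose that \<open>[s, t \<circ> \<psi>][t, \<psi>]\<close> lies in \<open>\<Theta>(w)\<close>, witnessed by \<open>u\<close> below \<open>s \<cdot> t\<close> and \<open>w\<close>. Shrinking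
  the second factor to \<open>t \<cdot> u\<^sup>\<star>\<close> gives \<open>s \<cdot> (t \<cdot> u\<^sup>\<star>) = u\<close>, so that \<open>\<Theta>(s)\<close> and \<open>\<Theta>(t \<cdot> u\<^sup>\<star>)\<close>
  multiply into \<open>\<Theta>(u) \<subseteq> \<Theta>(w)\<close>.\<close>

lemma continuous_germ_mult:
  "continuous_map (composable_space germ_category) germ_space (\<lambda>(x, y). germ_mult x y)"
  unfolding germ_space_def
proof (rule continuous_on_generated_topo)
  fix W assume "W \<in> range germ_slice"
  then obtain w where w: "W = germ_slice w"
    by blast
  let ?C = "composable_space germ_category"
  let ?V = "(\<lambda>(x, y). germ_mult x y) -` W \<inter> topspace ?C"
  have "\<exists>N. openin ?C N \<and> p \<in> N \<and> N \<subseteq> ?V" if p: "p \<in> ?V" for p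
  proof -
    obtain x y where xy: "p = (x, y)" "x \<in> topspace germ_space" "y \<in> topspace germ_space"
        "germ_dom x = germ_ran y" "germ_mult x y \<in> W"
      using p by (cases p) auto
    obtain s t \<psi> where st: "\<psi> \<in> prime_characters" "\<psi> (t\<^sup>\<star>)" "act t \<psi> \<in> prime_characters"
        "\<psi> ((s \<cdot> t)\<^sup>\<star>)" "x = germ s (act t \<psi>)" "y = germ t \<psi>"
      by (rule composable_cases[OF xy(2,3,4)]) blast
    have "germ (s \<cdot> t) \<psi> \<in> germ_slice w"
      using xy st w by (simp add: germ_mult_eq)
    then obtain u where u: "u \<preceq> w" "u \<preceq> s \<cdot> t" "\<psi> (u\<^sup>\<star>)"
      using germ_in_germ_slice_iff st by blast
    have stu: "s \<cdot> (t \<cdot> u\<^sup>\<star>) = u"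
      using u(2) by (simp add: natural_le_def assoc)
    have tu: "t \<cdot> u\<^sup>\<star> \<preceq> t" "\<psi> ((t \<cdot> u\<^sup>\<star>)\<^sup>\<star>)"
      using mul_projection_le st u by (simp_all add: star_mul_projection character_mul)
    define N where "N = (germ_slice s \<times> germ_slice (t \<cdot> u\<^sup>\<star>)) \<inter> {(x, y). germ_dom x = germ_ran y}"
    have "openin ?C N"
      unfolding N_def composable_space_def germ_category_simps
      by (intro openin_subtopology_Int) (simp_all add: openin_prod_Times_iff openin_germ_slice)
    moreover have "x \<in> germ_slice s"
      unfolding st(5) by (rule germ_in_own_slice) (use st in \<open>simp_all flip: star_mul\<close>)
    moreover have "y \<in> germ_slice (t \<cdot> u\<^sup>\<star>)"
      using germ_in_own_slice[OF st(1) tu(2)] germ_le[OF st(1) tu] st(6) by simp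
    moreover have "N \<subseteq> ?V"
    proof
      fix q assume "q \<in> N"
      then obtain x' y' where q: "q = (x', y')" "x' \<in> germ_slice s" "y' \<in> germ_slice (t \<cdot> u\<^sup>\<star>)"
          "germ_dom x' = germ_ran y'"
        by (auto simp: N_def)
      obtain \<phi>' where \<phi>': "\<phi>' \<in> prime_characters" "\<phi>' (s\<^sup>\<star>)" "x' = germ s \<phi>'"
        using q by (auto simp: germ_slice_eq)
      obtain \<psi>' where \<psi>': "\<psi>' \<in> prime_characters" "\<psi>' ((t \<cdot> u\<^sup>\<star>)\<^sup>\<star>)" "y' = germ (t \<cdot> u\<^sup>\<star>) \<psi>'"
        using q by (auto simp: germ_slice_eq)
      have eq: "\<phi>' = act (t \<cdot> u\<^sup>\<star>) \<psi>'"
        using q \<phi>' \<psi>' by simp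
      then have "\<psi>' ((s\<^sup>\<star> \<cdot> (t \<cdot> u\<^sup>\<star>))\<^sup>\<star>)"
        using \<phi>'(2) by simp
      then have "\<psi>' ((s \<cdot> (t \<cdot> u\<^sup>\<star>))\<^sup>\<star>)"
        by (simp only: star_mul[of s])
      then have "\<psi>' (u\<^sup>\<star>)" "germ_mult x' y' = germ u \<psi>'"
        using germ_mult_eq[of \<psi>' "t \<cdot> u\<^sup>\<star>" s] \<phi>'(3) \<psi>' eq stu by simp_all
      moreover from this have "germ u \<psi>' \<in> germ_slice w"
        using germ_in_own_slice germ_slice_mono[OF u(1)] \<psi>'(1) by blast
      moreover have "x' \<in> topspace germ_space" "y' \<in> topspace germ_space"
        using \<phi>' \<psi>' by simp_all
      ultimately show "q \<in> ?V"
        using q w by simp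
    qed
    ultimately show ?thesis
      using xy by (intro exI[of _ N]) (auto simp: N_def)
  qed
  then show "openin ?C ?V"
    by (subst openin_subopen) blast
next
  have "germ_mult x y \<in> topspace germ_space"
    if "x \<in> topspace germ_space" "y \<in> topspace germ_space" "germ_dom x = germ_ran y" for x y
    by (rule composable_cases[OF that]) (simp add: germ_mult_eq)
  then show "(\<lambda>(x, y). germ_mult x y) ` topspace (composable_space germ_category)
      \<subseteq> \<Union> (range germ_slice)"
    by (auto simp: germ_space_def)
qed

lemma topological_category_germs: "topological_category germ_category"
proof
  fix a assume "a \<in> topspace (cat_obj germ_category)"
  then obtain e where "a \<in> prime_characters" "e \<in> projections" "a e"
    using character_nonzero by auto
  then show "cat_dom germ_category (cat_unit germ_category a) = a"
    and "cat_ran germ_category (cat_unit germ_category a) = a"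
    by (simp_all add: germ_unit_eq act_projection)
next
  fix x assume "x \<in> topspace (cat_arr germ_category)"
  then obtain s \<phi> where x: "\<phi> \<in> prime_characters" "\<phi> (s\<^sup>\<star>)" "x = germ s \<phi>"
    by (auto elim: germ_cases)
  \<comment> \<open>the unit at \<open>\<phi>\<close> is represented by \<open>s\<^sup>\<star>\<close>, the unit at \<open>s \<circ> \<phi>\<close> by a local unit of \<open>s\<close>\<close>
  have "germ_mult x (germ_unit \<phi>) = germ_mult (germ s (act (s\<^sup>\<star>) \<phi>)) (germ (s\<^sup>\<star>) \<phi>)"
    using x germ_unit_eq[of \<phi> "s\<^sup>\<star>"] by (simp add: act_projection)
  also have "\<dots> = x"
    using x by (subst germ_mult_eq) (simp_all add: mul_star)
  finally show "cat_mult germ_category x (cat_unit germ_category (cat_dom germ_category x)) = x"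
    using x by simp
  obtain e where e: "e \<in> projections" "e \<cdot> s = s"
    using local_units unfolding has_local_units_def by blast
  have "germ_mult (germ_unit (act s \<phi>)) x = germ_mult (germ e (act s \<phi>)) (germ s \<phi>)"
    using x e act_in_prime_characters by (simp add: germ_unit_eq)
  also have "\<dots> = x"
    using x e by (simp add: germ_mult_eq)
  finally show "cat_mult germ_category (cat_unit germ_category (cat_ran germ_category x)) x = x"
    using x by simp
next
  fix x y assume "(x, y) \<in> topspace (composable_space germ_category)"
  then obtain s t \<psi> where "\<psi> \<in> prime_characters" "\<psi> (t\<^sup>\<star>)" "act t \<psi> \<in> prime_characters"
      "\<psi> ((s \<cdot> t)\<^sup>\<star>)" "x = germ s (act t \<psi>)" "y = germ t \<psi>"
    by (auto elim: composable_cases)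
  then show "cat_dom germ_category (cat_mult germ_category x y) = cat_dom germ_category y"
    and "cat_ran germ_category (cat_mult germ_category x y) = cat_ran germ_category x"
    by (simp_all add: germ_mult_eq act_mul flip: star_mul)
next
  fix x y z
  assume xy: "(x, y) \<in> topspace (composable_space germ_category)"
    and yz: "(y, z) \<in> topspace (composable_space germ_category)"
  obtain s t \<psi> where st: "\<psi> \<in> prime_characters" "\<psi> (t\<^sup>\<star>)" "act t \<psi> \<in> prime_characters"
      "\<psi> ((s \<cdot> t)\<^sup>\<star>)" "y = germ s (act t \<psi>)" "z = germ t \<psi>"
    using yz by (auto elim: composable_cases)
  obtain r \<phi> where r: "\<phi> \<in> prime_characters" "\<phi> (r\<^sup>\<star>)" "x = germ r \<phi>"
    using xy by (auto elim: germ_cases)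
  have "act t \<psi> (s\<^sup>\<star>)"
    using st by (simp flip: star_mul)
  then have \<phi>: "\<phi> = act s (act t \<psi>)"
    using xy r st by (simp del: act_apply)
  have "\<psi> ((r \<cdot> s \<cdot> t)\<^sup>\<star>)" "act t \<psi> ((r \<cdot> s)\<^sup>\<star>)"
    using r(2) by (simp_all add: \<phi> assoc flip: star_mul act_mul)
  then show "cat_mult germ_category (cat_mult germ_category x y) z =
      cat_mult germ_category x (cat_mult germ_category y z)"
    using germ_mult_eq[of "act t \<psi>" s r] germ_mult_eq[of \<psi> t "r \<cdot> s"] germ_mult_eq[of \<psi> t s]
      germ_mult_eq[of \<psi> "s \<cdot> t" r] st r(3) \<open>act t \<psi> (s\<^sup>\<star>)\<close>
    by (simp add: \<phi> act_mul assoc del: act_apply)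
qed (use continuous_germ_dom continuous_germ_ran continuous_germ_unit continuous_germ_mult in simp_all)

lemma compact_slice_germ_slice: "compact_slice germ_category (germ_slice s)"
  by (simp add: compact_slice_def compactin_germ_slice openin_germ_slice inj_on_germ_dom)

text \<open>The sets \<open>\<Theta>(s)\<close> are compact slices and already form a basis, so the category of germs is ample
  whether or not a range operation exists; only openness of the range map distinguishes the strongly ample case.\<close>

lemma ample_category_germs: "ample_category germ_category"
proof -
  interpret topological_category germ_category
    by (rule topological_category_germs)
  show ?thesis
  proof
    show "openin (cat_arr germ_category) = arbitrary union_of compact_slice germ_category"
      unfolding openin_topology_base_unique
    proof (intro conjI allI impI)
      fix V assume "compact_slice germ_category V"
      then show "openin (cat_arr germ_category) V"
        by (simp add: compact_slice_def)
    next
      fix U x assume "openin (cat_arr germ_category) U \<and> x \<in> U"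
      then obtain s where "x \<in> germ_slice s" "germ_slice s \<subseteq> U"
        unfolding germ_category_simps openin_germ_space_iff by blast
      then show "\<exists>V. compact_slice germ_category V \<and> x \<in> V \<and> V \<subseteq> U"
        using compact_slice_germ_slice by blast
    qed
  qed (simp_all add: locally_compact_character_space Hausdorff_character_space
      local_homeomorphism_germ_dom)
qed

end

section \<open>Range operations and openness of the range map\<close>

context boolean_semigroup_with_local_units
begin

text \<open>Write \<open>s\<^sup>+\<close> for \<open>rng s\<close>. The image \<open>r(\<Theta>(s))\<close> is compact, hence closed. If it missed a point of
  the set \<open>D\<^sub>e\<close> with \<open>e = s\<^sup>+\<close>, it would miss all of \<open>D\<^sub>g\<close> for some nonzero \<open>g \<le> s\<^sup>+\<close>. Then no
  character is positive on \<open>(g \<cdot> s)\<^sup>\<star>\<close>, so \<open>g \<cdot> s = 0\<close>; but \<open>(g \<cdot> s)\<^sup>+ = (g \<cdot> s\<^sup>+)\<^sup>+ = g\<close>.\<close>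

lemma act_image_eq_stone_set_plus:
  assumes "range_semigroup mul star rng"
  shows "act s ` stone_set (s\<^sup>\<star>) = stone_set (rng s)"
proof -
  interpret range_semigroup mul star rng
    by (rule assms)
  have proj: "rng s \<in> projections"
    by (metis star_plus star_projection)
  let ?I = "act s ` stone_set (s\<^sup>\<star>)"
  show ?thesis
  proof
    show "?I \<subseteq> stone_set (rng s)"
      using act_in_prime_characters proj by (auto simp: plus_mul)
    have "compactin germ_space (germ_slice s)"
      by (rule compactin_germ_slice)
    then have "compactin character_space ?I"
      using image_compactin[OF _ continuous_germ_ran] by (metis germ_ran_germ_slice)
    then have closed: "closedin character_space ?I"
      using Hausdorff_character_space compactin_imp_closedin by blast
    show "stone_set (rng s) \<subseteq> ?I"
    proof (rule ccontr)
      assume "\<not> stone_set (rng s) \<subseteq> ?I"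
      then obtain \<psi> where \<psi>: "\<psi> \<in> stone_set (rng s)" "\<psi> \<notin> ?I"
        by blast
      have "openin character_space (stone_set (rng s) - ?I)"
        using closed proj by (intro openin_diff openin_stone_set)
      then obtain g where g: "g \<in> projections" "\<psi> g" "stone_set g \<subseteq> stone_set (rng s) - ?I"
        using \<psi> unfolding openin_character_space_iff by blast
      have "g \<cdot> rng s = g"
        using g proj by (intro stone_set_subset_iff[THEN iffD1]) auto
      have "g \<cdot> s = zero"
      proof (rule ccontr)
        assume "g \<cdot> s \<noteq> zero"
        then obtain \<phi> where \<phi>: "\<phi> \<in> prime_characters" "\<phi> ((g \<cdot> s)\<^sup>\<star>)"
          using ex_character[of "(g \<cdot> s)\<^sup>\<star>"] eq_zero_iff_star by auto
        then have "\<phi> (s\<^sup>\<star>)"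
          using character_mono projection_mul_le g(1) by blast
        then have "act s \<phi> \<in> ?I" "act s \<phi> \<in> stone_set g"
          using \<phi> g act_in_prime_characters by auto
        with g(3) show False
          by blast
      qed
      have "rng g = g" "rng zero = zero"
        using plus_star[of g] plus_star[of zero] g(1) by simp_all
      then have "g = zero"
        using plus_of_mul[of g s] \<open>g \<cdot> s = zero\<close> \<open>g \<cdot> rng s = g\<close> by simp
      with g \<psi> show False
        using character_zero by auto
    qed
  qed
qed

lemma open_ran_if_act_images_open:
  assumes "\<And>s. openin character_space (act s ` stone_set (s\<^sup>\<star>))"
  shows "open_map germ_space character_space germ_ran"
  unfolding open_map_def
proof (intro allI impI)
  fix U assume "openin germ_space U"
  then have "U = \<Union>(germ_slice ` {s. germ_slice s \<subseteq> U})"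
    unfolding openin_germ_space_iff by blast
  then have "germ_ran ` U = (\<Union>s\<in>{s. germ_slice s \<subseteq> U}. act s ` stone_set (s\<^sup>\<star>))"
    by (metis (no_types, lifting) SUP_cong germ_ran_germ_slice image_UN)
  then show "openin character_space (germ_ran ` U)"
    using assms by auto
qed

text \<open>The image \<open>r(\<Theta>(s))\<close> is compact and open, hence equal to \<open>D\<^sub>e\<close> for a unique projection \<open>e\<close>, which
  is taken as \<open>s\<^sup>+\<close>. The axioms follow by comparing sets of characters. In particular, both
  \<open>(x \<cdot> y)\<^sup>+\<close> and \<open>(x \<cdot> y\<^sup>+)\<^sup>+\<close> describe the image under \<open>x\<close> of those characters that are positive
  on \<open>x\<^sup>\<star>\<close> and reached by \<open>y\<close>: composing with \<open>y\<close> reaches exactly \<open>D\<close> of \<open>y\<^sup>+\<close>, and \<open>y\<^sup>+\<close> itself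
  fixes each of its members.\<close>

lemma range_semigroup_if_act_images_open:
  assumes "\<And>s. openin character_space (act s ` stone_set (s\<^sup>\<star>))"
  shows "\<exists>plus. range_semigroup mul star plus"
proof -
  have "\<exists>e\<in>projections. act s ` stone_set (s\<^sup>\<star>) = stone_set e" for s
  proof -
    have "compactin character_space (act s ` stone_set (s\<^sup>\<star>))"
      using image_compactin[OF compactin_germ_slice[of s] continuous_germ_ran]
      by (simp only: germ_ran_germ_slice)
    then show ?thesis
      using assms compact_open_eq_stone_set by metis
  qed
  then obtain rng where proj: "\<And>s. rng s \<in> projections"
      and image: "\<And>s. act s ` stone_set (s\<^sup>\<star>) = stone_set (rng s)"
    by metis
  have stone_set_inj: "e = f" if "e \<in> projections" "f \<in> projections" "stone_set e = stone_set f" for e f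
    using that stone_set_subset_iff projection_commute by (metis order_refl)
  have plus_projection: "rng e = e" if e: "e \<in> projections" for e
  proof -
    have "act e ` stone_set (e\<^sup>\<star>) = stone_set e"
      using e act_projection by force
    then show ?thesis
      using image proj e stone_set_inj by metis
  qed
  have "range_semigroup mul star rng"
  proof
    fix x y
    show "rng x \<cdot> x = x"
    proof -
      have "\<phi> ((rng x \<cdot> x)\<^sup>\<star>)" if "\<phi> \<in> prime_characters" "\<phi> (x\<^sup>\<star>)" for \<phi>
      proof -
        have "act x \<phi> \<in> stone_set (rng x)"
          using that by (simp flip: image)
        then show ?thesis
          using proj by simp
      qed
      then have "x\<^sup>\<star> \<cdot> (rng x \<cdot> x)\<^sup>\<star> = x\<^sup>\<star>"
        by (intro projection_le_if_characters_le) simp_all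
      then have "x \<cdot> (rng x \<cdot> x)\<^sup>\<star> = x"
        by (metis assoc mul_star)
      then show ?thesis
        using projection_mul_eq proj by metis
    qed
    show "rng x \<cdot> rng y = rng y \<cdot> rng x"
      using proj by (simp add: projection_commute)
    show "rng (rng x \<cdot> rng y) = rng x \<cdot> rng y"
      using proj by (simp add: plus_projection)
    show "rng (x \<cdot> y) = rng (x \<cdot> rng y)"
    proof (rule stone_set_inj)
      have "stone_set (rng (x \<cdot> y)) = act x ` {act y \<phi> |\<phi>. \<phi> \<in> stone_set (y\<^sup>\<star>) \<and> act y \<phi> (x\<^sup>\<star>)}"
      proof -
        have "\<phi> \<in> stone_set ((x \<cdot> y)\<^sup>\<star>) \<longleftrightarrow> \<phi> \<in> stone_set (y\<^sup>\<star>) \<and> act y \<phi> (x\<^sup>\<star>)" for \<phi>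
          using character_mono projection_mul_le[of "x\<^sup>\<star>" y] by (auto simp: star_mul[of x])
        then show ?thesis
          unfolding image[symmetric] act_mul by blast
      qed
      also have "\<dots> = act x ` {\<psi> \<in> act y ` stone_set (y\<^sup>\<star>). \<psi> (x\<^sup>\<star>)}"
        by blast
      also have "\<dots> = act x ` {\<psi> \<in> stone_set (rng y). \<psi> (x\<^sup>\<star>)}"
        by (simp only: image)
      also have "\<dots> = act x ` act (rng y) ` {\<psi> \<in> stone_set (rng y). \<psi> (x\<^sup>\<star>)}"
        using proj by (force simp: act_projection image_image intro!: image_cong)
      also have "\<dots> = act (x \<cdot> rng y) ` stone_set ((x \<cdot> rng y)\<^sup>\<star>)"
      proof -
        have "stone_set ((x \<cdot> rng y)\<^sup>\<star>) = {\<psi> \<in> stone_set (rng y). \<psi> (x\<^sup>\<star>)}"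
          using proj by (auto simp: star_mul_projection character_mul)
        then show ?thesis
          by (simp add: act_mul image_image)
      qed
      also have "\<dots> = stone_set (rng (x \<cdot> rng y))"
        by (rule image)
      finally show "stone_set (rng (x \<cdot> y)) = stone_set (rng (x \<cdot> rng y))" .
    qed (rule proj)+
    show "(rng x)\<^sup>\<star> = rng x"
      using proj by simp
    show "rng (x\<^sup>\<star>) = x\<^sup>\<star>"
      by (simp add: plus_projection)
  qed
  then show ?thesis
    by blast
qed

end

theorem corollary9p5:
  fixes mul :: "'a \<Rightarrow> 'a \<Rightarrow> 'a" and star :: "'a \<Rightarrow> 'a" and zero :: 'a
  assumes "boolean_restriction_semigroup mul star zero"
    and "restriction_semigroup.has_local_units mul star"
  shows "(\<exists>plus. range_semigroup mul star plus) \<longleftrightarrow>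
    strongly_ample_category (restriction_semigroup.germ_category mul star)"
proof -
  interpret boolean_semigroup_with_local_units mul star zero
    using assms by (simp add: boolean_semigroup_with_local_units_def
        boolean_semigroup_with_local_units_axioms_def)
  show ?thesis
  proof
    assume "\<exists>plus. range_semigroup mul star plus"
    then obtain rng where range: "range_semigroup mul star rng"
      by blast
    then have "rng s \<in> projections" for s
      by (metis range_semigroup.star_plus star_projection)
    then have "open_map germ_space character_space germ_ran"
      using act_image_eq_stone_set_plus[OF range]
      by (intro open_ran_if_act_images_open) (simp add: openin_stone_set)
    then show "strongly_ample_category germ_category"
      using ample_category_germs
      by (simp add: strongly_ample_category_def strongly_ample_category_axioms_def)
  next
    assume "strongly_ample_category germ_category"
    then have "open_map germ_space character_space germ_ran"
      using strongly_ample_category.open_ran by force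
    then have "openin character_space (act s ` stone_set (star s))" for s
      using openin_germ_slice by (metis germ_ran_germ_slice open_map_def)
    then show "\<exists>plus. range_semigroup mul star plus"
      by (rule range_semigroup_if_act_images_open)
  qed
qed

end
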